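(* Let $s\ge0$ and let $a=[(a_\varepsilon)_\varepsilon]\in\mathcal{G}^s_{*,\mathrm{loc}}(\mathbb{R})$. Assume there are positive constants $c_1,c_2$ such that $c_1\le a_\varepsilon(x)\le c_2$ for all $x\in\mathbb{R}$ and $\varepsilon\in(0,1)$. Let $\tau$ be a real number and $b\in\mathcal{G}^\tau_{*,\mathrm{loc}}(\mathbb{R})$. If $u\in\mathcal{G}(\mathbb{R}^2)$ is the (unique) solution of the Cauchy problem $$\partial_t u+a(x)\,\partial_x u=0,\qquad u|_{t=0}=b,$$ in the variables $(x,t)\in\mathbb{R}^2$, then: - if $s>0$, then $u\in\mathcal{G}^r_{*,\mathrm{loc}}(\mathbb{R}^2)$ with $r=\min(\tau,s+1)$; - if $s=0$, then $u\in\mathcal{G}^r_{*,\mathrm{loc}}(\mathbb{R}^2)$ for $r=\min(\tau,1)-\sigma$ with $\sigma>0$ arbitrary.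
   Context: Colombeau algebra: for $n\in\mathbb{N}$ and $I=(0,1]$, let $\mathcal{E}_M(\mathbb{R}^n)$ be the set of nets $(u_\varepsilon)_{\varepsilon\in I}$ in $C^\infty(\mathbb{R}^n)$ such that for every compact $K\subset\mathbb{R}^n$ and every $\alpha\in\mathbb{N}_0^n$ there is $N\in\mathbb{N}$ with $\sup_{x\in K}|\partial^\alpha u_\varepsilon(x)|=O(\varepsilon^{-N})$ as $\varepsilon\to0$. Let $\mathcal{N}(\mathbb{R}^n)$ be the ideal of those $(u_\varepsilon)_\varepsilon\in\mathcal{E}_M(\mathbb{R}^n)$ such that for every compact $K$ and every $m\in\mathbb{N}$, $\sup_{x\in K}|u_\varepsilon(x)|=O(\varepsilon^m)$ as $\varepsilon\to0$. Then $\mathcal{G}(\mathbb{R}^n)=\mathcal{E}_M(\mathbb{R}^n)/\mathcal{N}(\mathbb{R}^n)$, a differential algebra with operations (sum, product, partial derivatives, restriction to $t=0$) defined componentwise on representatives; $[(u_\varepsilon)_\varepsilon]$ denotes the class of $(u_\varepsilon)_\varepsilon$. The differential equation and the initial condition are understood as equalities in $\mathcal{G}(\mathbb{R}^2)$ and $\mathcal{G}(\mathbb{R})$, respectively, with $a$ viewed as an element of $\mathcal{G}(\mathbb{R}^2)$ independent of $t$. Local generalized Zygmund regularity: for $s\in\mathbb{R}$, $u=[(u_\varepsilon)_\varepsilon]\in\mathcal{G}(\mathbb{R}^n)$ belongs to $\mathcal{G}^s_{*,\mathrm{loc}}(\mathbb{R}^n)$ if for every compact $K\subset\mathbb{R}^n$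 and every $\alpha\in\mathbb{N}_0^n$, as $\varepsilon\to0$: $\|\partial^\alpha u_\varepsilon\|_{L^\infty(K)}=O(1)$ if $0\le|\alpha|<s$; $=O(\log(1/\varepsilon))$ if $|\alpha|=s\in\mathbb{N}_0$; $=O(\varepsilon^{s-|\alpha|})$ if $|\alpha|>s$. *)

theory Defs
  imports "HOL-Analysis.Analysis" "HOL-Library.Landau_Symbols"
begin

text \<open>
  Iterated partial derivatives are indexed by lists of coordinate directions
  \<open>bs \<in> lists Basis\<close> instead of multi-indices: \<open>bs\<close> stands for the multi-index
  counting the occurrences of each direction, and \<open>length bs\<close> is its order.
  On smooth functions the order of the entries is irrelevant (Schwarz), so
  quantifying over all lists of length \<open>k\<close> is quantifying over all multi-indices
  of order \<open>k\<close>.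
\<close>

definition partial_deriv :: "'a::euclidean_space \<Rightarrow> ('a \<Rightarrow> complex) \<Rightarrow> 'a \<Rightarrow> complex"
  where "partial_deriv b f = (\<lambda>x. frechet_derivative f (at x) b)"

definition iter_partial :: "'a::euclidean_space list \<Rightarrow> ('a \<Rightarrow> complex) \<Rightarrow> 'a \<Rightarrow> complex"
  where "iter_partial bs f = foldr partial_deriv bs f"

text \<open>
  Differentiability of every iterated partial derivative also gives continuity of
  all of them, so the following is the space of \<open>C\<^sup>\<infinity>\<close> functions on the whole space.
\<close>

definition smooth :: "('a::euclidean_space \<Rightarrow> complex) \<Rightarrow> bool"
  where "smooth f \<longleftrightarrow> (\<forall>bs\<in>lists Basis. \<forall>x. iter_partial bs f differentiable (at x))"

definition sup_norm_on :: "'a set \<Rightarrow> ('a \<Rightarrow> complex) \<Rightarrow> real"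
  where "sup_norm_on K f = (SUP x\<in>K. norm (f x))"

text \<open>
  A net \<open>u\<close> is a function of the parameter \<open>\<epsilon>\<close>; only its values for \<open>\<epsilon> \<in> {0<..1}\<close>
  matter. Compact sets are taken nonempty because the real supremum of the empty
  set is unspecified.
\<close>

type_synonym 'a net = "real \<Rightarrow> 'a \<Rightarrow> complex"

definition moderate_nets :: "'a::euclidean_space net set"
  where "moderate_nets =
    {u. (\<forall>\<epsilon>\<in>{0<..1}. smooth (u \<epsilon>)) \<and>
        (\<forall>K. compact K \<longrightarrow> K \<noteq> {} \<longrightarrow> (\<forall>bs\<in>lists Basis. \<exists>N::nat.
          (\<lambda>\<epsilon>. sup_norm_on K (iter_partial bs (u \<epsilon>))) \<in> O[at_right 0](\<lambda>\<epsilon>. 1 / \<epsilon> ^ N)))}"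

definition negligible_nets :: "'a::euclidean_space net set"
  where "negligible_nets =
    {u \<in> moderate_nets. \<forall>K. compact K \<longrightarrow> K \<noteq> {} \<longrightarrow>
      (\<forall>m::nat. (\<lambda>\<epsilon>. sup_norm_on K (u \<epsilon>)) \<in> O[at_right 0](\<lambda>\<epsilon>. \<epsilon> ^ m))}"

definition colombeau_rel :: "('a::euclidean_space net \<times> 'a net) set"
  where "colombeau_rel =
    {(u, v). u \<in> moderate_nets \<and> v \<in> moderate_nets \<and> (\<lambda>\<epsilon> x. u \<epsilon> x - v \<epsilon> x) \<in> negligible_nets}"

definition colombeau :: "'a::euclidean_space net set set"
  where "colombeau = moderate_nets // colombeau_rel"

definition colombeau_class :: "'a::euclidean_space net \<Rightarrow> 'a net set"
  where "colombeau_class u = colombeau_rel `` {u}"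

text \<open>
  Operations on classes. The union over all representatives is a single class
  because each componentwise operation respects the equivalence relation.
\<close>

definition G_zero :: "'a::euclidean_space net set"
  where "G_zero = colombeau_class (\<lambda>\<epsilon> x. 0)"

definition G_add :: "'a::euclidean_space net set \<Rightarrow> 'a net set \<Rightarrow> 'a net set"
  where "G_add U V = (\<Union>u\<in>U. \<Union>v\<in>V. colombeau_class (\<lambda>\<epsilon> x. u \<epsilon> x + v \<epsilon> x))"

definition G_mult :: "'a::euclidean_space net set \<Rightarrow> 'a net set \<Rightarrow> 'a net set"
  where "G_mult U V = (\<Union>u\<in>U. \<Union>v\<in>V. colombeau_class (\<lambda>\<epsilon> x. u \<epsilon> x * v \<epsilon> x))"

definition G_partial :: "'a::euclidean_space \<Rightarrow> 'a net set \<Rightarrow> 'a net set"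
  where "G_partial b U = (\<Union>u\<in>U. colombeau_class (\<lambda>\<epsilon>. partial_deriv b (u \<epsilon>)))"

text \<open>Points of the plane are pairs \<open>(x, t)\<close>.\<close>

definition G_initial :: "(real \<times> real) net set \<Rightarrow> real net set"
  where "G_initial U = (\<Union>u\<in>U. colombeau_class (\<lambda>\<epsilon> x. u \<epsilon> (x, 0)))"

definition G_const_in_t :: "real net set \<Rightarrow> (real \<times> real) net set"
  where "G_const_in_t A = (\<Union>a\<in>A. colombeau_class (\<lambda>\<epsilon> (x, t). a \<epsilon> x))"

definition zygmund_loc :: "real \<Rightarrow> 'a::euclidean_space net set set"
  where "zygmund_loc s =
    {U \<in> colombeau. \<exists>u\<in>U. \<forall>K. compact K \<longrightarrow> K \<noteq> {} \<longrightarrow> (\<forall>bs\<in>lists Basis.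
      (real (length bs) < s \<longrightarrow>
        (\<lambda>\<epsilon>. sup_norm_on K (iter_partial bs (u \<epsilon>))) \<in> O[at_right 0](\<lambda>\<epsilon>. 1)) \<and>
      (real (length bs) = s \<longrightarrow>
        (\<lambda>\<epsilon>. sup_norm_on K (iter_partial bs (u \<epsilon>))) \<in> O[at_right 0](\<lambda>\<epsilon>. ln (1 / \<epsilon>))) \<and>
      (real (length bs) > s \<longrightarrow>
        (\<lambda>\<epsilon>. sup_norm_on K (iter_partial bs (u \<epsilon>)))
          \<in> O[at_right 0](\<lambda>\<epsilon>. \<epsilon> powr (s - real (length bs)))))}"

definition transport_solution ::
    "real net set \<Rightarrow> real net set \<Rightarrow> (real \<times> real) net set \<Rightarrow> bool"
  where "transport_solution A B U \<longleftrightarrow>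
    U \<in> colombeau \<and>
    G_add (G_partial (0, 1) U) (G_mult (G_const_in_t A) (G_partial (1, 0) U)) = G_zero \<and>
    G_initial U = B"

end

theory Submission
  imports Defs "HOL-Real_Asymp.Real_Asymp"
begin

text \<open>
  The estimates are derived for an arbitrary representative \<open>w\<close> of the solution, without
  constructing the flow of \<open>a\<close>. Since \<open>a\<close> does not depend on \<open>t\<close>, every \<open>\<partial>\<^sub>t\<^sup>j w\<close> satisfies the
  transport equation up to a net whose derivatives are all bounded, so by integration along
  characteristics it is bounded by its values at \<open>t = 0\<close>. There \<open>\<partial>\<^sub>t w = n - a \<partial>\<^sub>x w\<close> with \<open>n\<close>
  negligible expresses time derivatives by derivatives of \<open>a\<close> and of the initial value, and
  the same equation, read as \<open>a \<partial>\<^sub>x w = n - \<partial>\<^sub>t w\<close>, recovers all mixed derivatives from the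
  \<open>\<partial>\<^sub>t\<^sup>j w\<close>. In the Leibniz terms \<open>\<partial>\<^sup>i a \<cdot> \<partial>\<^sup>l w\<close> of order \<open>i + l\<close> the second factor always carries
  a derivative, \<open>l \<ge> 1\<close>; together with \<open>r \<le> s + 1\<close> this makes the product of the weights of
  orders \<open>i\<close> (for \<open>a\<close>) and \<open>l\<close> (for \<open>w\<close>) dominated by the weight of order \<open>i + l\<close>. For
  \<open>s = 0\<close> the power weights of \<open>a\<close> do not absorb a logarithm, hence the loss of \<open>\<sigma>\<close>, which
  keeps \<open>r < 1 \<le> l\<close>.
\<close>

section \<open>Iterated partial derivatives of smooth functions\<close>

lemma iter_partial_Nil [simp]: "iter_partial [] f = f"
  and iter_partial_Cons: "iter_partial (b # bs) f = partial_deriv b (iter_partial bs f)"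
  and iter_partial_append: "iter_partial (bs @ cs) f = iter_partial bs (iter_partial cs f)"
  and iter_partial_snoc: "iter_partial (bs @ [b]) f = iter_partial bs (partial_deriv b f)"
  by (simp_all add: iter_partial_def)

lemma partial_deriv_eqI:
  assumes "(f has_derivative f') (at x)"
  shows "partial_deriv b f x = f' b"
  using frechet_derivative_at[OF assms] by (simp add: partial_deriv_def)

lemma smooth_iter_partial:
  assumes "smooth f" "bs \<in> lists Basis"
  shows "smooth (iter_partial bs f)"
  unfolding smooth_def
proof (intro ballI allI)
  fix cs :: "'a list" and x assume "cs \<in> lists Basis"
  then have "cs @ bs \<in> lists Basis" using assms by simp
  then show "iter_partial cs (iter_partial bs f) differentiable at x"
    using assms(1) by (metis iter_partial_append smooth_def)
qed

lemma smooth_partial_deriv: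
  assumes "smooth f" "b \<in> Basis"
  shows "smooth (partial_deriv b f)"
  using smooth_iter_partial[OF assms(1), of "[b]"] assms(2) by (simp add: iter_partial_Cons)

lemma smooth_has_derivative:
  assumes "smooth f"
  shows "(f has_derivative frechet_derivative f (at x)) (at x)"
proof -
  have "iter_partial [] f differentiable at x"
    using assms unfolding smooth_def by blast
  then show ?thesis by (simp add: frechet_derivative_works)
qed

lemma smooth_continuous_on:
  assumes "smooth f"
  shows "continuous_on S f"
  by (intro continuous_at_imp_continuous_on ballI has_derivative_continuous[OF smooth_has_derivative[OF assms]])

lemma continuous_on_iter_partial:
  assumes "smooth f" "bs \<in> lists Basis"
  shows "continuous_on S (iter_partial bs f)"
  using smooth_continuous_on smooth_iter_partial assms by blast

lemma smooth_has_vector_derivative_line: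
  assumes "smooth f"
  shows "((\<lambda>s. f (x + s *\<^sub>R b)) has_vector_derivative partial_deriv b f (x + s *\<^sub>R b)) (at s within S)"
proof -
  let ?D = "frechet_derivative f (at (x + s *\<^sub>R b))"
  have D: "(f has_derivative ?D) (at (x + s *\<^sub>R b))"
    using smooth_has_derivative[OF assms] .
  have "((\<lambda>s. x + s *\<^sub>R b) has_derivative (\<lambda>h. h *\<^sub>R b)) (at s within S)"
    by (auto intro!: derivative_eq_intros)
  from has_derivative_compose[OF this D] 
  have "((\<lambda>s. f (x + s *\<^sub>R b)) has_derivative (\<lambda>h. ?D (h *\<^sub>R b))) (at s within S)" .
  moreover have "?D (h *\<^sub>R b) = h *\<^sub>R ?D b" for h
    using has_derivative_bounded_linear[OF D] by (simp add: linear_simps)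
  ultimately show ?thesis
    by (simp add: has_vector_derivative_def partial_deriv_def)
qed

section \<open>Symmetry of second partial derivatives\<close>

lemma mean_value_interior:
  fixes F :: "real \<Rightarrow> real"
  assumes "h > 0" and "\<And>s. (F has_real_derivative F' s) (at s)"
  shows "\<exists>s\<in>{0<..<h}. F h - F 0 = h * F' s"
  using MVT2[of 0 h F F'] assms by fastforce

text \<open>The second difference is the increment of \<open>\<lambda>s. F s h - F s 0\<close>: a
  mean value step in \<open>s\<close>, followed by one in \<open>t\<close>, produces the mixed
  derivative.\<close>

lemma mixed_second_difference:
  fixes F Fs Fst :: "real \<Rightarrow> real \<Rightarrow> real"
  assumes "h > 0"
    and s: "\<And>s t. ((\<lambda>s. F s t) has_real_derivative Fs s t) (at s)"
    and t: "\<And>s t. ((\<lambda>t. Fs s t) has_real_derivative Fst s t) (at t)"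
  shows "\<exists>s\<in>{0<..<h}. \<exists>t\<in>{0<..<h}. F h h - F h 0 - F 0 h + F 0 0 = h * h * Fst s t"
proof -
  have "((\<lambda>s. F s h - F s 0) has_real_derivative Fs s h - Fs s 0) (at s)" for s
    by (intro derivative_intros s)
  then obtain s' where s': "s' \<in> {0<..<h}"
      "(F h h - F h 0) - (F 0 h - F 0 0) = h * (Fs s' h - Fs s' 0)"
    using mean_value_interior[OF assms(1), of "\<lambda>s. F s h - F s 0" "\<lambda>s. Fs s h - Fs s 0"] by auto
  moreover obtain t' where t': "t' \<in> {0<..<h}" "Fs s' h - Fs s' 0 = h * Fst s' t'"
    using mean_value_interior[OF assms(1) t, of s'] by auto
  ultimately have "F h h - F h 0 - F 0 h + F 0 0 = h * h * Fst s' t'"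
    by (simp add: algebra_simps)
  then show ?thesis using s'(1) t'(1) by blast
qed

text \<open>The second difference over the square of side \<open>h\<close> does not depend on which
  variable is treated first, so both mixed derivatives attain a common value at points that tend to
  the origin with \<open>h\<close>. Continuity there excludes a gap.\<close>

lemma mixed_partials_eq:
  fixes F Fs Ft Fst Fts :: "real \<Rightarrow> real \<Rightarrow> real"
  assumes s: "\<And>s t. ((\<lambda>s. F s t) has_real_derivative Fs s t) (at s)"
    and t: "\<And>s t. ((\<lambda>t. F s t) has_real_derivative Ft s t) (at t)"
    and st: "\<And>s t. ((\<lambda>t. Fs s t) has_real_derivative Fst s t) (at t)"
    and ts: "\<And>s t. ((\<lambda>s. Ft s t) has_real_derivative Fts s t) (at s)"
    and cst: "isCont (\<lambda>(s, t). Fst s t) (0, 0)"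
    and cts: "isCont (\<lambda>(s, t). Fts s t) (0, 0)"
  shows "Fst 0 0 = Fts 0 0"
proof (rule ccontr)
  assume ne: "Fst 0 0 \<noteq> Fts 0 0"
  define e where "e = \<bar>Fst 0 0 - Fts 0 0\<bar> / 2"
  have "e > 0" using ne by (simp add: e_def)
  obtain d1 where d1: "d1 > 0" "\<And>p. dist p (0,0) < d1 \<Longrightarrow> dist (case p of (s, t) \<Rightarrow> Fst s t) (Fst 0 0) < e"
    using cst \<open>e > 0\<close> unfolding continuous_at_eps_delta by auto
  obtain d2 where d2: "d2 > 0" "\<And>p. dist p (0,0) < d2 \<Longrightarrow> dist (case p of (s, t) \<Rightarrow> Fts s t) (Fts 0 0) < e"
    using cts \<open>e > 0\<close> unfolding continuous_at_eps_delta by auto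
  \<comment> \<open>Points of the open square of side \<open>h\<close> are closer than
    \<open>2 * h\<close> to the origin, hence within both continuity radii.\<close>
  define h where "h = min d1 d2 / 2"
  have h: "h > 0" "2 * h \<le> d1" "2 * h \<le> d2" using d1(1) d2(1) by (auto simp: h_def)
  have near: "dist (s, t) (0, 0) < 2 * h" if "s \<in> {0<..<h}" "t \<in> {0<..<h}" for s t :: real
  proof -
    have "dist (s, t) (0, 0) \<le> \<bar>s\<bar> + \<bar>t\<bar>"
      by (simp add: dist_Pair_Pair sqrt_sum_squares_le_sum_abs)
    then show ?thesis using that by simp
  qed
  obtain p q where pq: "p \<in> {0<..<h}" "q \<in> {0<..<h}" "F h h - F h 0 - F 0 h + F 0 0 = h * h * Fst p q"
    using mixed_second_difference[OF h(1) s st] by blast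
  obtain q' p' where pq': "q' \<in> {0<..<h}" "p' \<in> {0<..<h}" "F h h - F 0 h - F h 0 + F 0 0 = h * h * Fts p' q'"
    using mixed_second_difference[OF h(1), of "\<lambda>t s. F s t", OF t ts] by blast
  have "h * h * Fst p q = h * h * Fts p' q'" using pq(3) pq'(3) by linarith
  then have "Fst p q = Fts p' q'" using h(1) by simp
  moreover have "\<bar>Fst p q - Fst 0 0\<bar> < e" using d1(2)[of "(p, q)"] near[OF pq(1,2)] h
    by (auto simp: dist_real_def)
  moreover have "\<bar>Fts p' q' - Fts 0 0\<bar> < e" using d2(2)[of "(p', q')"] near[OF pq'(2,1)] h
    by (auto simp: dist_real_def)
  ultimately show False unfolding e_def by argo
qed

lemma partial_deriv_commute:
  assumes f: "smooth f" and b: "b \<in> Basis" and c: "c \<in> Basis"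
  shows "partial_deriv b (partial_deriv c f) = partial_deriv c (partial_deriv b f)"
proof
  fix x
  have fb: "smooth (partial_deriv b f)" and fc: "smooth (partial_deriv c f)"
    using smooth_partial_deriv f b c by auto
  \<comment> \<open>The mean value theorem requires real functions of real variables, so
    \<open>f\<close> is restricted to the two-parameter family \<open>P\<close> through
    \<open>x\<close> and paired with an arbitrary \<open>e\<close>.\<close>
  define P where "P s t = x + s *\<^sub>R b + t *\<^sub>R c" for s t :: real
  have eq: "partial_deriv c (partial_deriv b f) (P 0 0) \<bullet> e = partial_deriv b (partial_deriv c f) (P 0 0) \<bullet> e"
    for e :: complex
  proof (rule mixed_partials_eq[where F = "\<lambda>s t. f (P s t) \<bullet> e"
        and Fs = "\<lambda>s t. partial_deriv b f (P s t) \<bullet> e" and Ft = "\<lambda>s t. partial_deriv c f (P s t) \<bullet> e"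
        and Fst = "\<lambda>s t. partial_deriv c (partial_deriv b f) (P s t) \<bullet> e"
        and Fts = "\<lambda>s t. partial_deriv b (partial_deriv c f) (P s t) \<bullet> e"])
    have comp: "((\<lambda>s. g (P s t) \<bullet> e) has_real_derivative partial_deriv b g (P s t) \<bullet> e) (at s)"
               "((\<lambda>t. g (P s t) \<bullet> e) has_real_derivative partial_deriv c g (P s t) \<bullet> e) (at t)"
      if "smooth g" for g s t
    proof -
      have "((\<lambda>s. g (P s t)) has_vector_derivative partial_deriv b g (P s t)) (at s)"
        using smooth_has_vector_derivative_line[OF that, of "x + t *\<^sub>R c" b s UNIV]
        by (simp add: P_def algebra_simps)
      moreover have "((\<lambda>t. g (P s t)) has_vector_derivative partial_deriv c g (P s t)) (at t)"
        using smooth_has_vector_derivative_line[OF that, of "x + s *\<^sub>R b" c t UNIV]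
        by (simp add: P_def algebra_simps)
      ultimately show "((\<lambda>s. g (P s t) \<bullet> e) has_real_derivative partial_deriv b g (P s t) \<bullet> e) (at s)"
               "((\<lambda>t. g (P s t) \<bullet> e) has_real_derivative partial_deriv c g (P s t) \<bullet> e) (at t)"
        unfolding has_real_derivative_iff_has_vector_derivative
        using bounded_linear.has_vector_derivative[OF bounded_linear_inner_left] by blast+
    qed
    show "((\<lambda>s. f (P s t) \<bullet> e) has_real_derivative partial_deriv b f (P s t) \<bullet> e) (at s)"
         "((\<lambda>t. f (P s t) \<bullet> e) has_real_derivative partial_deriv c f (P s t) \<bullet> e) (at t)"
         "((\<lambda>t. partial_deriv b f (P s t) \<bullet> e) has_real_derivative partial_deriv c (partial_deriv b f) (P s t) \<bullet> e) (at t)"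
         "((\<lambda>s. partial_deriv c f (P s t) \<bullet> e) has_real_derivative partial_deriv b (partial_deriv c f) (P s t) \<bullet> e) (at s)"
      for s t using comp f fb fc by auto
    have cont: "isCont (\<lambda>(s, t). g (P s t) \<bullet> e) (0, 0)" if "smooth g" for g
    proof -
      have "continuous_on UNIV (\<lambda>p. P (fst p) (snd p))"
        unfolding P_def by (intro continuous_intros)
      then have "continuous_on UNIV (\<lambda>p. g (P (fst p) (snd p)) \<bullet> e)"
        by (intro continuous_intros continuous_on_compose2[OF smooth_continuous_on[OF that, of UNIV]]) auto
      then show ?thesis
        by (simp add: case_prod_unfold continuous_on_eq_continuous_at)
    qed
    show "isCont (\<lambda>(s, t). partial_deriv c (partial_deriv b f) (P s t) \<bullet> e) (0, 0)"
         "isCont (\<lambda>(s, t). partial_deriv b (partial_deriv c f) (P s t) \<bullet> e) (0, 0)"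
      using cont smooth_partial_deriv fb fc b c by auto
  qed
  have "P 0 0 = x" by (simp add: P_def)
  then show "partial_deriv b (partial_deriv c f) x = partial_deriv c (partial_deriv b f) x"
    using vector_eq_rdot[of "partial_deriv b (partial_deriv c f) x"] eq by metis
qed

lemma iter_partial_partial_commute:
  assumes "smooth f" "b \<in> Basis" "bs \<in> lists Basis"
  shows "iter_partial bs (partial_deriv b f) = partial_deriv b (iter_partial bs f)"
  using assms(3)
proof (induction bs)
  case (Cons c cs)
  then have "partial_deriv c (partial_deriv b (iter_partial cs f)) = partial_deriv b (partial_deriv c (iter_partial cs f))"
    by (intro partial_deriv_commute smooth_iter_partial assms) auto
  with Cons show ?case by (auto simp: iter_partial_Cons)
qed simp

text \<open>The transport equation concerns first derivatives of \<open>w\<close>, so to use it one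
  chosen entry of the list has to act first. The list \<open>cs\<close> does not depend on
  \<open>f\<close>, and the multiset identity supplies the lengths and counts on which the later
  inductions run.\<close>

lemma iter_partial_move_last:
  fixes bs :: "'a::euclidean_space list"
  assumes "bs \<in> lists Basis" "b \<in> set bs"
  obtains cs where "cs \<in> lists Basis" "mset bs = add_mset b (mset cs)"
    "\<And>f. smooth f \<Longrightarrow> iter_partial bs f = iter_partial cs (partial_deriv b f)"
proof -
  obtain us vs where bs: "bs = us @ b # vs" using split_list[OF assms(2)] by blast
  have "iter_partial bs f = iter_partial (us @ vs) (partial_deriv b f)" if "smooth f" for f
    using assms iter_partial_partial_commute[OF that, of b vs]
    by (simp add: bs iter_partial_append iter_partial_Cons)
  then show ?thesis using that[of "us @ vs"] assms bs by auto
qed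

section \<open>Derivatives of sums, differences and products\<close>

lemma iter_partial_add:
  assumes f: "smooth f" and g: "smooth g" and bs: "bs \<in> lists Basis"
  shows "iter_partial bs (\<lambda>x. f x + g x) = (\<lambda>x. iter_partial bs f x + iter_partial bs g x)"
  using bs
proof (induction bs)
  case (Cons b bs)
  have "partial_deriv b (\<lambda>x. iter_partial bs f x + iter_partial bs g x) x =
      partial_deriv b (iter_partial bs f) x + partial_deriv b (iter_partial bs g) x" for x
    unfolding partial_deriv_def[of b "iter_partial bs f"] partial_deriv_def[of b "iter_partial bs g"]
    by (rule partial_deriv_eqI, rule has_derivative_add)
      (use Cons in \<open>auto intro!: smooth_has_derivative smooth_iter_partial f g\<close>)
  then show ?case using Cons by (auto simp: iter_partial_Cons)
qed simp

lemma iter_partial_diff: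
  assumes f: "smooth f" and g: "smooth g" and bs: "bs \<in> lists Basis"
  shows "iter_partial bs (\<lambda>x. f x - g x) = (\<lambda>x. iter_partial bs f x - iter_partial bs g x)"
  using bs
proof (induction bs)
  case (Cons b bs)
  have "partial_deriv b (\<lambda>x. iter_partial bs f x - iter_partial bs g x) x =
      partial_deriv b (iter_partial bs f) x - partial_deriv b (iter_partial bs g) x" for x
    unfolding partial_deriv_def[of b "iter_partial bs f"] partial_deriv_def[of b "iter_partial bs g"]
    by (rule partial_deriv_eqI, rule has_derivative_diff)
      (use Cons in \<open>auto intro!: smooth_has_derivative smooth_iter_partial f g\<close>)
  then show ?case using Cons by (auto simp: iter_partial_Cons)
qed simp

lemma smooth_add:
  assumes "smooth f" "smooth g"
  shows "smooth (\<lambda>x. f x + g x)"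
  using assms unfolding smooth_def
  by (auto simp: iter_partial_add[OF assms])

text \<open>With repetitions, so that the Leibniz rule needs no binomial coefficients.\<close>

fun splits :: "'a list \<Rightarrow> ('a list \<times> 'a list) list" where
  "splits [] = [([], [])]"
| "splits (b # bs) = map (\<lambda>(p, q). (b # p, q)) (splits bs) @ map (\<lambda>(p, q). (p, b # q)) (splits bs)"

lemma mset_splits: "(p, q) \<in> set (splits bs) \<Longrightarrow> mset p + mset q = mset bs"
  by (induction bs arbitrary: p q) auto

lemma length_splits: "(p, q) \<in> set (splits bs) \<Longrightarrow> length p + length q = length bs"
  by (metis mset_splits size_mset size_union)

lemma splits_lists:
  assumes "(p, q) \<in> set (splits bs)" "bs \<in> lists S"
  shows "p \<in> lists S" "q \<in> lists S"
  using arg_cong[OF mset_splits[OF assms(1)], of set_mset] assms(2) by auto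

text \<open>Isolates the single Leibniz term in which no derivative falls on the first factor. When
  that factor is the coefficient \<open>A\<close>, this is the term of highest order in the
  solution, the one to be solved for.\<close>

lemma splits_eq_Cons: "\<exists>ps. splits bs = ps @ [([], bs)] \<and> (\<forall>(p, q)\<in>set ps. p \<noteq> [])"
proof (induction bs)
  case (Cons b bs)
  then obtain ps where "splits bs = ps @ [([], bs)]" "\<forall>(p, q)\<in>set ps. p \<noteq> []" by blast
  then show ?case
    by (intro exI[of _ "map (\<lambda>(p, q). (b # p, q)) (splits bs) @ map (\<lambda>(p, q). (p, b # q)) ps"]) auto
qed simp

lemma has_derivative_sum_list_mult:
  fixes F G :: "'i \<Rightarrow> 'a::real_normed_vector \<Rightarrow> complex"
  assumes "\<And>p q. (p, q) \<in> set L \<Longrightarrow> (F p has_derivative F' p) (at x) \<and> (G q has_derivative G' q) (at x)"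
  shows "((\<lambda>x. \<Sum>(p, q)\<leftarrow>L. F p x * G q x) has_derivative
    (\<lambda>h. \<Sum>(p, q)\<leftarrow>L. F' p h * G q x + F p x * G' q h)) (at x)"
  using assms
proof (induction L)
  case (Cons pq L)
  obtain p q where pq: "pq = (p, q)" by (cases pq)
  have "(F p has_derivative F' p) (at x)" "(G q has_derivative G' q) (at x)"
    using Cons.prems[of p q] pq by auto
  moreover have "((\<lambda>x. \<Sum>(p, q)\<leftarrow>L. F p x * G q x) has_derivative
    (\<lambda>h. \<Sum>(p, q)\<leftarrow>L. F' p h * G q x + F p x * G' q h)) (at x)"
    by (rule Cons.IH, rule Cons.prems) simp
  ultimately show ?case using has_derivative_add[OF has_derivative_mult] by (simp add: pq add.commute)
qed simp

lemma has_derivative_leibniz: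
  assumes "smooth f" "smooth g" "bs \<in> lists Basis"
  shows "((\<lambda>x. \<Sum>(p, q)\<leftarrow>splits bs. iter_partial p f x * iter_partial q g x) has_derivative
    (\<lambda>h. \<Sum>(p, q)\<leftarrow>splits bs. frechet_derivative (iter_partial p f) (at x) h * iter_partial q g x +
      iter_partial p f x * frechet_derivative (iter_partial q g) (at x) h)) (at x)"
proof (rule has_derivative_sum_list_mult)
  fix p q assume pq: "(p, q) \<in> set (splits bs)"
  show "(iter_partial p f has_derivative frechet_derivative (iter_partial p f) (at x)) (at x) \<and>
      (iter_partial q g has_derivative frechet_derivative (iter_partial q g) (at x)) (at x)"
    using splits_lists[OF pq assms(3)] by (intro conjI smooth_has_derivative smooth_iter_partial assms)
qed

lemma iter_partial_mult:
  assumes f: "smooth f" and g: "smooth g" and bs: "bs \<in> lists Basis"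
  shows "iter_partial bs (\<lambda>x. f x * g x) =
    (\<lambda>x. \<Sum>(p, q)\<leftarrow>splits bs. iter_partial p f x * iter_partial q g x)"
  using bs
proof (induction bs)
  case (Cons b bs)
  then have "partial_deriv b (\<lambda>x. \<Sum>(p, q)\<leftarrow>splits bs. iter_partial p f x * iter_partial q g x) x =
      (\<Sum>(p, q)\<leftarrow>splits bs. partial_deriv b (iter_partial p f) x * iter_partial q g x +
        iter_partial p f x * partial_deriv b (iter_partial q g) x)" for x
    unfolding partial_deriv_def[of b "iter_partial _ _"]
    by (intro partial_deriv_eqI has_derivative_leibniz f g) auto
  with Cons show ?case
    by (simp add: iter_partial_Cons case_prod_unfold o_def sum_list_addf)
qed simp

lemma smooth_mult:
  assumes "smooth f" "smooth g"
  shows "smooth (\<lambda>x. f x * g x)"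
  unfolding smooth_def
proof (intro ballI allI)
  fix bs :: "'a list" and x assume bs: "bs \<in> lists Basis"
  show "iter_partial bs (\<lambda>x. f x * g x) differentiable at x"
    unfolding iter_partial_mult[OF assms bs] by (rule differentiableI[OF has_derivative_leibniz[OF assms bs]])
qed

section \<open>Asymptotic bounds on compact sets\<close>

text \<open>A uniform pointwise bound in place of a supremum: it can be handled by pointwise
  inequalities, makes sense for every set \<open>K\<close>, and avoids real suprema of unbounded
  sets.\<close>

definition bigo_on :: "'a set \<Rightarrow> 'a net \<Rightarrow> (real \<Rightarrow> real) \<Rightarrow> bool"
  where "bigo_on K u g \<longleftrightarrow> (\<exists>C\<ge>0. \<forall>\<^sub>F \<epsilon> in at_right 0. \<forall>x\<in>K. norm (u \<epsilon> x) \<le> C * \<bar>g \<epsilon>\<bar>)"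

lemma bigo_onI:
  assumes "\<forall>\<^sub>F \<epsilon> in at_right 0. \<forall>x\<in>K. norm (u \<epsilon> x) \<le> C * \<bar>g \<epsilon>\<bar>"
  shows "bigo_on K u g"
  unfolding bigo_on_def
proof (intro exI conjI)
  show "\<forall>\<^sub>F \<epsilon> in at_right 0. \<forall>x\<in>K. norm (u \<epsilon> x) \<le> \<bar>C\<bar> * \<bar>g \<epsilon>\<bar>"
    using assms
  proof (rule eventually_mono)
    fix \<epsilon> assume "\<forall>x\<in>K. norm (u \<epsilon> x) \<le> C * \<bar>g \<epsilon>\<bar>"
    then show "\<forall>x\<in>K. norm (u \<epsilon> x) \<le> \<bar>C\<bar> * \<bar>g \<epsilon>\<bar>"
      by (meson abs_ge_self abs_ge_zero mult_right_mono order_trans)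
  qed
qed simp

lemma bigo_onE:
  assumes "bigo_on K u g"
  obtains C where "C \<ge> 0" "\<forall>\<^sub>F \<epsilon> in at_right 0. \<forall>x\<in>K. norm (u \<epsilon> x) \<le> C * \<bar>g \<epsilon>\<bar>"
  using assms unfolding bigo_on_def by blast

lemma eventually_unit_interval: "\<forall>\<^sub>F \<epsilon> in at_right (0::real). \<epsilon> \<in> {0<..<1}"
  by (rule eventually_at_right_real) simp

text \<open>The comparison point \<open>y\<close> may depend on \<open>x\<close> and lie in another
  set. This covers both the projection of \<open>K\<close> to the x-axis and the division by the
  coefficient.\<close>

lemma bigo_on_dominated:
  assumes "bigo_on L v g"
    and "\<forall>\<^sub>F \<epsilon> in at_right 0. \<forall>x\<in>K. \<exists>y\<in>L. norm (u \<epsilon> x) \<le> B * norm (v \<epsilon> y)"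
    and "B \<ge> 0"
  shows "bigo_on K u g"
proof -
  obtain C where C: "\<forall>\<^sub>F \<epsilon> in at_right 0. \<forall>x\<in>L. norm (v \<epsilon> x) \<le> C * \<bar>g \<epsilon>\<bar>"
    using bigo_onE[OF assms(1)] by blast
  show ?thesis
  proof (rule bigo_onI[where C = "B * C"], use C assms(2) in eventually_elim)
    case (elim \<epsilon>)
    show ?case
    proof
      fix x assume "x \<in> K"
      then obtain y where y: "y \<in> L" "norm (u \<epsilon> x) \<le> B * norm (v \<epsilon> y)" using elim by blast
      then have "B * norm (v \<epsilon> y) \<le> B * (C * \<bar>g \<epsilon>\<bar>)" using elim \<open>B \<ge> 0\<close> by (simp add: mult_left_mono)
      with y show "norm (u \<epsilon> x) \<le> B * C * \<bar>g \<epsilon>\<bar>" by (simp add: mult.assoc)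
    qed
  qed
qed

text \<open>Smoothness of a net is known only for \<epsilon> in the unit interval, so identities
  between iterated derivatives hold only eventually; bounds are carried across them here.\<close>

lemma bigo_on_cong_norm:
  assumes "bigo_on K v g" "\<forall>\<^sub>F \<epsilon> in at_right 0. \<forall>x\<in>K. norm (u \<epsilon> x) = norm (v \<epsilon> x)"
  shows "bigo_on K u g"
  by (rule bigo_on_dominated[OF assms(1), where B = 1], use assms(2) in eventually_elim) fastforce+

lemma bigo_on_trans:
  assumes "bigo_on K u g" "g \<in> O[at_right 0](h)"
  shows "bigo_on K u h"
proof -
  obtain C where C: "C \<ge> 0" "\<forall>\<^sub>F \<epsilon> in at_right 0. \<forall>x\<in>K. norm (u \<epsilon> x) \<le> C * \<bar>g \<epsilon>\<bar>"
    using bigo_onE[OF assms(1)] by blast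
  obtain D where D: "\<forall>\<^sub>F \<epsilon> in at_right 0. norm (g \<epsilon>) \<le> D * norm (h \<epsilon>)"
    using assms(2) by (elim landau_o.bigE)
  show ?thesis
  proof (rule bigo_onI[where C = "C * D"], use C(2) D in eventually_elim)
    case (elim \<epsilon>)
    then show ?case using mult_left_mono[OF elim(2) \<open>C \<ge> 0\<close>] by (fastforce simp: mult.assoc)
  qed
qed

lemma bigo_on_add:
  assumes "bigo_on K u g" "bigo_on K v g"
  shows "bigo_on K (\<lambda>\<epsilon> x. u \<epsilon> x + v \<epsilon> x) g"
proof -
  obtain C D where C: "\<forall>\<^sub>F \<epsilon> in at_right 0. \<forall>x\<in>K. norm (u \<epsilon> x) \<le> C * \<bar>g \<epsilon>\<bar>"
    and D: "\<forall>\<^sub>F \<epsilon> in at_right 0. \<forall>x\<in>K. norm (v \<epsilon> x) \<le> D * \<bar>g \<epsilon>\<bar>"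
    using assms unfolding bigo_on_def by blast
  from C D show ?thesis
    by (intro bigo_onI[where C = "C + D"], eventually_elim)
      (auto simp: distrib_right intro: norm_triangle_mono)
qed

lemma bigo_on_uminus: "bigo_on K u g \<Longrightarrow> bigo_on K (\<lambda>\<epsilon> x. - u \<epsilon> x) g"
  by (erule bigo_on_cong_norm) simp

lemma bigo_on_diff:
  assumes "bigo_on K u g" "bigo_on K v g"
  shows "bigo_on K (\<lambda>\<epsilon> x. u \<epsilon> x - v \<epsilon> x) g"
  using bigo_on_add[OF assms(1) bigo_on_uminus[OF assms(2)]] by simp

lemma bigo_on_mult:
  assumes "bigo_on K u g" "bigo_on K v h"
  shows "bigo_on K (\<lambda>\<epsilon> x. u \<epsilon> x * v \<epsilon> x) (\<lambda>\<epsilon>. g \<epsilon> * h \<epsilon>)"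
proof -
  obtain C D where "C \<ge> 0" and C: "\<forall>\<^sub>F \<epsilon> in at_right 0. \<forall>x\<in>K. norm (u \<epsilon> x) \<le> C * \<bar>g \<epsilon>\<bar>"
    and D: "\<forall>\<^sub>F \<epsilon> in at_right 0. \<forall>x\<in>K. norm (v \<epsilon> x) \<le> D * \<bar>h \<epsilon>\<bar>"
    using assms unfolding bigo_on_def by blast
  from C D show ?thesis
  proof (intro bigo_onI[where C = "C * D"], eventually_elim)
    case (elim \<epsilon>)
    then have "norm (u \<epsilon> x) * norm (v \<epsilon> x) \<le> (C * \<bar>g \<epsilon>\<bar>) * (D * \<bar>h \<epsilon>\<bar>)" if "x \<in> K" for x
      using \<open>C \<ge> 0\<close> that by (intro mult_mono) auto
    then show ?case by (simp add: norm_mult abs_mult mult_ac)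
  qed
qed

lemma bigo_on_zero: "bigo_on K (\<lambda>\<epsilon> x. 0) g"
  by (rule bigo_onI[where C = 0]) simp

lemma bigo_on_sum_list:
  assumes "\<And>i. i \<in> set L \<Longrightarrow> bigo_on K (\<lambda>\<epsilon>. u i \<epsilon>) g"
  shows "bigo_on K (\<lambda>\<epsilon> x. \<Sum>i\<leftarrow>L. u i \<epsilon> x) g"
  using assms by (induction L) (auto intro: bigo_on_add bigo_on_zero)

text \<open>From left to right the pointwise bound itself makes the supremum meaningful; from right
  to left this comes from continuity on a compact set.\<close>

lemma bigo_on_iff_sup_norm_on:
  assumes "compact K" "K \<noteq> {}" and cont: "\<And>\<epsilon>. \<epsilon> \<in> {0<..1} \<Longrightarrow> continuous_on K (u \<epsilon>)"
  shows "bigo_on K u g \<longleftrightarrow> (\<lambda>\<epsilon>. sup_norm_on K (u \<epsilon>)) \<in> O[at_right 0](g)"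
proof
  assume "bigo_on K u g"
  then obtain C where C: "\<forall>\<^sub>F \<epsilon> in at_right 0. \<forall>x\<in>K. norm (u \<epsilon> x) \<le> C * \<bar>g \<epsilon>\<bar>"
    by (rule bigo_onE)
  show "(\<lambda>\<epsilon>. sup_norm_on K (u \<epsilon>)) \<in> O[at_right 0](g)"
  proof (rule bigoI[where c = C], use C in eventually_elim)
    case (elim \<epsilon>)
    \<comment> \<open>A point of \<open>K\<close> shows that the supremum is nonnegative, so that
      its norm is the supremum itself.\<close>
    obtain x where x: "x \<in> K" using assms by blast
    have le: "sup_norm_on K (u \<epsilon>) \<le> C * \<bar>g \<epsilon>\<bar>"
      unfolding sup_norm_on_def using assms elim by (intro cSUP_least) auto
    have "norm (u \<epsilon> x) \<le> sup_norm_on K (u \<epsilon>)"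
      unfolding sup_norm_on_def using elim x by (intro cSUP_upper bdd_aboveI2[where M = "C * \<bar>g \<epsilon>\<bar>"]) auto
    then have "0 \<le> sup_norm_on K (u \<epsilon>)" using norm_ge_zero order_trans by blast
    with le show ?case by simp
  qed
next
  assume "(\<lambda>\<epsilon>. sup_norm_on K (u \<epsilon>)) \<in> O[at_right 0](g)"
  then obtain C where C: "\<forall>\<^sub>F \<epsilon> in at_right 0. norm (sup_norm_on K (u \<epsilon>)) \<le> C * norm (g \<epsilon>)"
    by (elim landau_o.bigE)
  show "bigo_on K u g"
  proof (rule bigo_onI[where C = C], use C eventually_unit_interval in eventually_elim)
    case (elim \<epsilon>)
    then have "continuous_on K (\<lambda>x. norm (u \<epsilon> x))"
      by (intro continuous_on_norm cont) auto
    then have "bdd_above ((\<lambda>x. norm (u \<epsilon> x)) ` K)"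
      using assms by (intro bounded_imp_bdd_above compact_imp_bounded compact_continuous_image)
    then have "norm (u \<epsilon> x) \<le> sup_norm_on K (u \<epsilon>)" if "x \<in> K" for x
      unfolding sup_norm_on_def using that by (intro cSUP_upper)
    then show ?case using elim by fastforce
  qed
qed

lemma powr_bigo_powr:
  assumes "p \<ge> q"
  shows "(\<lambda>\<epsilon>::real. \<epsilon> powr p) \<in> O[at_right 0](\<lambda>\<epsilon>. \<epsilon> powr q)"
  by (rule bigoI[where c = 1], use eventually_unit_interval in eventually_elim)
    (use assms in \<open>auto intro: powr_mono'\<close>)

lemma inverse_power_bigo_inverse_power:
  assumes "m \<le> n"
  shows "(\<lambda>\<epsilon>::real. 1 / \<epsilon> ^ m) \<in> O[at_right 0](\<lambda>\<epsilon>. 1 / \<epsilon> ^ n)"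
  by (rule bigoI[where c = 1], use eventually_unit_interval in eventually_elim)
    (use assms in \<open>auto intro!: divide_left_mono power_decreasing\<close>)

section \<open>Moderate and negligible nets\<close>

text \<open>Pointwise bounds hold trivially on the empty set, so the restriction to nonempty
  \<open>K\<close> in the definition disappears. The continuity needed to compare with the supremum
  comes from the smoothness clause.\<close>

lemma moderate_nets_iff:
  "u \<in> moderate_nets \<longleftrightarrow> (\<forall>\<epsilon>\<in>{0<..1}. smooth (u \<epsilon>)) \<and>
    (\<forall>K. compact K \<longrightarrow> (\<forall>bs\<in>lists Basis. \<exists>N::nat. bigo_on K (\<lambda>\<epsilon>. iter_partial bs (u \<epsilon>)) (\<lambda>\<epsilon>. 1 / \<epsilon> ^ N)))"
  (is "_ \<longleftrightarrow> ?S \<and> (\<forall>K. compact K \<longrightarrow> ?B K)")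
proof -
  have "bigo_on {} v g" for v :: "'a net" and g by (rule bigo_onI) simp
  then have empty: "?B {}" by blast
  have "?B K \<longleftrightarrow> (\<forall>bs\<in>lists Basis. \<exists>N::nat.
      (\<lambda>\<epsilon>. sup_norm_on K (iter_partial bs (u \<epsilon>))) \<in> O[at_right 0](\<lambda>\<epsilon>. 1 / \<epsilon> ^ N))"
    if "compact K" "K \<noteq> {}" ?S for K
    using that by (intro ball_cong refl ex_cong1 bigo_on_iff_sup_norm_on continuous_on_iter_partial) auto
  then have eq: "?S \<Longrightarrow> (compact K \<longrightarrow> ?B K) \<longleftrightarrow> (compact K \<longrightarrow> K \<noteq> {} \<longrightarrow> (\<forall>bs\<in>lists Basis. \<exists>N::nat.
      (\<lambda>\<epsilon>. sup_norm_on K (iter_partial bs (u \<epsilon>))) \<in> O[at_right 0](\<lambda>\<epsilon>. 1 / \<epsilon> ^ N)))" for K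
    using empty by (cases "K = {}") auto
  show ?thesis unfolding moderate_nets_def mem_Collect_eq by (intro conj_cong refl all_cong1 eq[symmetric])
qed

lemma moderate_netsD:
  assumes "u \<in> moderate_nets"
  shows "\<epsilon> \<in> {0<..1} \<Longrightarrow> smooth (u \<epsilon>)"
    and "compact K \<Longrightarrow> bs \<in> lists Basis \<Longrightarrow> \<exists>N::nat. bigo_on K (\<lambda>\<epsilon>. iter_partial bs (u \<epsilon>)) (\<lambda>\<epsilon>. 1 / \<epsilon> ^ N)"
  using assms unfolding moderate_nets_iff by blast+

lemma eventually_smooth:
  assumes "u \<in> moderate_nets"
  shows "\<forall>\<^sub>F \<epsilon> in at_right 0. smooth (u \<epsilon>)"
  using eventually_unit_interval by eventually_elim (simp add: moderate_netsD(1)[OF assms])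

lemma negligible_nets_iff:
  "u \<in> negligible_nets \<longleftrightarrow> u \<in> moderate_nets \<and> (\<forall>K. compact K \<longrightarrow> (\<forall>m::nat. bigo_on K u (\<lambda>\<epsilon>. \<epsilon> ^ m)))"
  (is "_ \<longleftrightarrow> _ \<and> (\<forall>K. compact K \<longrightarrow> ?B K)")
proof -
  have empty: "?B {}" by (auto intro: bigo_onI[where C = 0])
  have "?B K \<longleftrightarrow> (\<forall>m::nat. (\<lambda>\<epsilon>. sup_norm_on K (u \<epsilon>)) \<in> O[at_right 0](\<lambda>\<epsilon>. \<epsilon> ^ m))"
    if "compact K" "K \<noteq> {}" "u \<in> moderate_nets" for K
    using that by (intro all_cong1 bigo_on_iff_sup_norm_on smooth_continuous_on moderate_netsD(1))
  then have "u \<in> moderate_nets \<Longrightarrow> (compact K \<longrightarrow> ?B K) \<longleftrightarrow>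
      (compact K \<longrightarrow> K \<noteq> {} \<longrightarrow> (\<forall>m::nat. (\<lambda>\<epsilon>. sup_norm_on K (u \<epsilon>)) \<in> O[at_right 0](\<lambda>\<epsilon>. \<epsilon> ^ m)))" for K
    using empty by (cases "K = {}") auto
  then show ?thesis unfolding negligible_nets_def by auto
qed

lemma moderate_partial_deriv:
  assumes "u \<in> moderate_nets" "b \<in> Basis"
  shows "(\<lambda>\<epsilon>. partial_deriv b (u \<epsilon>)) \<in> moderate_nets"
  unfolding moderate_nets_iff
proof (intro conjI ballI allI impI)
  fix K :: "'a set" and bs :: "'a list" assume "compact K" "bs \<in> lists Basis"
  then show "\<exists>N::nat. bigo_on K (\<lambda>\<epsilon>. iter_partial bs (partial_deriv b (u \<epsilon>))) (\<lambda>\<epsilon>. 1 / \<epsilon> ^ N)"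
    using moderate_netsD(2)[OF assms(1), of K "bs @ [b]"] assms(2) by (simp add: iter_partial_snoc)
qed (use assms in \<open>intro smooth_partial_deriv moderate_netsD(1)\<close>)

lemma moderate_add:
  assumes "u \<in> moderate_nets" "v \<in> moderate_nets"
  shows "(\<lambda>\<epsilon> x. u \<epsilon> x + v \<epsilon> x) \<in> moderate_nets"
  unfolding moderate_nets_iff
proof (intro conjI ballI allI impI)
  fix K :: "'a set" and bs :: "'a list" assume *: "compact K" "bs \<in> lists Basis"
  obtain M N where "bigo_on K (\<lambda>\<epsilon>. iter_partial bs (u \<epsilon>)) (\<lambda>\<epsilon>. 1 / \<epsilon> ^ M)"
      "bigo_on K (\<lambda>\<epsilon>. iter_partial bs (v \<epsilon>)) (\<lambda>\<epsilon>. 1 / \<epsilon> ^ N)"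
    using moderate_netsD(2) assms * by metis
  then have "bigo_on K (\<lambda>\<epsilon>. iter_partial bs (u \<epsilon>)) (\<lambda>\<epsilon>. 1 / \<epsilon> ^ max M N)"
      "bigo_on K (\<lambda>\<epsilon>. iter_partial bs (v \<epsilon>)) (\<lambda>\<epsilon>. 1 / \<epsilon> ^ max M N)"
    by (auto elim!: bigo_on_trans intro!: inverse_power_bigo_inverse_power)
  note sum = bigo_on_add[OF this]
  show "\<exists>N::nat. bigo_on K (\<lambda>\<epsilon>. iter_partial bs (\<lambda>x. u \<epsilon> x + v \<epsilon> x)) (\<lambda>\<epsilon>. 1 / \<epsilon> ^ N)"
    by (rule exI, rule bigo_on_cong_norm[OF sum],
        use eventually_smooth[OF assms(1)] eventually_smooth[OF assms(2)] in eventually_elim)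
      (simp add: iter_partial_add *)
qed (use assms in \<open>intro smooth_add moderate_netsD(1)\<close>)

lemma moderate_mult:
  assumes "u \<in> moderate_nets" "v \<in> moderate_nets"
  shows "(\<lambda>\<epsilon> x. u \<epsilon> x * v \<epsilon> x) \<in> moderate_nets"
  unfolding moderate_nets_iff
proof (intro conjI ballI allI impI)
  fix K :: "'a set" and bs :: "'a list" assume *: "compact K" "bs \<in> lists Basis"
  define P where "P = (\<lambda>(p, q) \<epsilon> x. iter_partial p (u \<epsilon>) x * iter_partial q (v \<epsilon>) x)"
  have "\<exists>N::nat. bigo_on K (P pq) (\<lambda>\<epsilon>. 1 / \<epsilon> ^ N)" if "pq \<in> set (splits bs)" for pq
  proof -
    obtain p q where pq: "pq = (p, q)" by (cases pq)
    then have "p \<in> lists Basis" "q \<in> lists Basis" using that splits_lists * by blast+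
    then obtain M N where "bigo_on K (\<lambda>\<epsilon>. iter_partial p (u \<epsilon>)) (\<lambda>\<epsilon>. 1 / \<epsilon> ^ M)"
        "bigo_on K (\<lambda>\<epsilon>. iter_partial q (v \<epsilon>)) (\<lambda>\<epsilon>. 1 / \<epsilon> ^ N)"
      using moderate_netsD(2) assms *(1) by metis
    from bigo_on_mult[OF this] have "bigo_on K (P pq) (\<lambda>\<epsilon>. 1 / \<epsilon> ^ (M + N))"
      by (simp add: P_def pq power_add)
    then show ?thesis by blast
  qed
  then obtain N where N: "\<And>pq. pq \<in> set (splits bs) \<Longrightarrow> bigo_on K (P pq) (\<lambda>\<epsilon>. 1 / \<epsilon> ^ (N pq :: nat))"
    by metis
  \<comment> \<open>There are finitely many Leibniz terms, so the largest of their exponents serves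
    all of them.\<close>
  have "bigo_on K (\<lambda>\<epsilon> x. \<Sum>pq\<leftarrow>splits bs. P pq \<epsilon> x) (\<lambda>\<epsilon>. 1 / \<epsilon> ^ Max (N ` set (splits bs)))"
    by (rule bigo_on_sum_list, rule bigo_on_trans[OF N]) (auto intro!: inverse_power_bigo_inverse_power Max_ge)
  note sum = this
  show "\<exists>N::nat. bigo_on K (\<lambda>\<epsilon>. iter_partial bs (\<lambda>x. u \<epsilon> x * v \<epsilon> x)) (\<lambda>\<epsilon>. 1 / \<epsilon> ^ N)"
    by (rule exI, rule bigo_on_cong_norm[OF sum],
        use eventually_smooth[OF assms(1)] eventually_smooth[OF assms(2)] in eventually_elim)
      (simp add: iter_partial_mult * P_def case_prod_unfold)
qed (use assms in \<open>intro smooth_mult moderate_netsD(1)\<close>)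

section \<open>Negligibility of derivatives\<close>

text \<open>An elementary form of Landau's inequality: \<phi>' varies by at most
  \<open>h * B\<close> on the interval, so the linearization of \<phi> at 0 errs by at most
  \<open>h * (h * B)\<close>.\<close>

lemma norm_derivative_le_of_second_derivative:
  fixes \<phi> :: "real \<Rightarrow> 'b::real_normed_vector"
  assumes "h \<ge> 0"
    and \<phi>: "\<And>s. s \<in> {0..h} \<Longrightarrow> (\<phi> has_vector_derivative \<phi>' s) (at s within {0..h})"
    and \<phi>': "\<And>s. s \<in> {0..h} \<Longrightarrow> (\<phi>' has_vector_derivative \<phi>'' s) (at s within {0..h})"
    and B: "\<And>s. s \<in> {0..h} \<Longrightarrow> norm (\<phi>'' s) \<le> B"
  shows "h * norm (\<phi>' 0) \<le> norm (\<phi> h) + norm (\<phi> 0) + h * (h * B)"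
proof -
  have "B \<ge> 0" using order_trans[OF norm_ge_zero B[of 0]] \<open>h \<ge> 0\<close> by simp
  have "norm (\<phi>' s - \<phi>' 0) \<le> h * B" if s: "s \<in> {0..h}" for s
  proof -
    have "norm (\<phi>' s - \<phi>' 0) \<le> B * norm (s - 0)"
      using \<phi>' B s \<open>h \<ge> 0\<close> unfolding has_vector_derivative_def
      by (intro differentiable_bound[of "{0..h}" \<phi>' "\<lambda>s k. k *\<^sub>R \<phi>'' s"])
        (auto intro!: onorm_le simp: mult.commute[of B] mult_left_mono)
    also have "\<dots> \<le> h * B" using s \<open>B \<ge> 0\<close> by (simp add: mult.commute[of B] mult_right_mono)
    finally show ?thesis .
  qed
  then have "norm (\<phi> h - \<phi> 0 - (h - 0) *\<^sub>R \<phi>' 0) \<le> norm (h - 0) * (h * B)"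
    using \<open>h \<ge> 0\<close> \<phi> by (intro vector_differentiable_bound_linearization[of "{0..h}"])
      (auto simp: closed_segment_eq_real_ivl)
  moreover have "norm (h *\<^sub>R \<phi>' 0) \<le> norm (\<phi> h) + norm (\<phi> 0) + norm (\<phi> h - \<phi> 0 - h *\<^sub>R \<phi>' 0)"
    using norm_triangle_ineq4[of "\<phi> h - \<phi> 0" "\<phi> h - \<phi> 0 - h *\<^sub>R \<phi>' 0"] norm_triangle_ineq4[of "\<phi> h" "\<phi> 0"]
    by simp
  ultimately show ?thesis using \<open>h \<ge> 0\<close> by simp
qed

text \<open>The second derivative being moderate, a difference quotient whose step is a high
  power of \<open>\<epsilon>\<close> controls the first derivative by the function itself.\<close>

lemma negligible_partial_deriv:
  assumes u: "u \<in> negligible_nets" and b: "b \<in> Basis"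
  shows "(\<lambda>\<epsilon>. partial_deriv b (u \<epsilon>)) \<in> negligible_nets"
  unfolding negligible_nets_iff
proof (intro conjI allI impI)
  have um: "u \<in> moderate_nets" and un: "\<And>K m. compact K \<Longrightarrow> bigo_on K u (\<lambda>\<epsilon>. \<epsilon> ^ m)"
    using u unfolding negligible_nets_iff by auto
  show "(\<lambda>\<epsilon>. partial_deriv b (u \<epsilon>)) \<in> moderate_nets" using moderate_partial_deriv[OF um b] .
  fix K :: "'a set" and m :: nat assume "compact K"
  \<comment> \<open>\<open>K\<close> is thickened by unit segments in direction \<open>b\<close>, so
    that it contains the end point of every difference step of length at most 1.\<close>
  define L where "L = (\<lambda>(x, s). x + s *\<^sub>R b) ` (K \<times> {0..1})"
  have "compact L" unfolding L_def case_prod_unfold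
    using \<open>compact K\<close> by (intro compact_continuous_image continuous_intros compact_Times) auto
  have L: "x + s *\<^sub>R b \<in> L" if "x \<in> K" "s \<in> {0..1}" for x s using that unfolding L_def by force
  obtain N where "bigo_on L (\<lambda>\<epsilon>. iter_partial [b, b] (u \<epsilon>)) (\<lambda>\<epsilon>. 1 / \<epsilon> ^ N)"
    using moderate_netsD(2)[OF um \<open>compact L\<close>, of "[b, b]"] b by auto
  then obtain C where C: "C \<ge> 0" "\<forall>\<^sub>F \<epsilon> in at_right 0. \<forall>x\<in>L.
      norm (partial_deriv b (partial_deriv b (u \<epsilon>)) x) \<le> C * \<bar>1 / \<epsilon> ^ N\<bar>"
    by (auto simp: iter_partial_Cons elim: bigo_onE)
  \<comment> \<open>With the step \<open>h = \<epsilon> ^ (m + N)\<close> this exponent leaves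
    \<epsilon> ^ m after division by \<open>h\<close>, while the second derivative contributes
    \<open>h / \<epsilon> ^ N\<close>, again \<epsilon> ^ m.\<close>
  obtain D where D: "D \<ge> 0" "\<forall>\<^sub>F \<epsilon> in at_right 0. \<forall>x\<in>L. norm (u \<epsilon> x) \<le> D * \<bar>\<epsilon> ^ (m + N + m)\<bar>"
    using bigo_onE[OF un[OF \<open>compact L\<close>]] by blast
  show "bigo_on K (\<lambda>\<epsilon>. partial_deriv b (u \<epsilon>)) (\<lambda>\<epsilon>. \<epsilon> ^ m)"
  proof (rule bigo_onI[where C = "2 * D + C"],
      use C(2) D(2) eventually_unit_interval eventually_smooth[OF um] in eventually_elim)
    case (elim \<epsilon>)
    then have \<epsilon>: "0 < \<epsilon>" "\<epsilon> < 1" by auto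
    define h where "h = \<epsilon> ^ (m + N)"
    have h: "0 < h" "h \<le> 1" using \<epsilon> by (auto simp: h_def power_le_one)
    have smooth': "smooth (partial_deriv b (u \<epsilon>))" using elim b by (intro smooth_partial_deriv)
    show ?case
    proof
      fix x assume "x \<in> K"
      have "h * norm (partial_deriv b (u \<epsilon>) (x + 0 *\<^sub>R b)) \<le>
          norm (u \<epsilon> (x + h *\<^sub>R b)) + norm (u \<epsilon> (x + 0 *\<^sub>R b)) + h * (h * (C / \<epsilon> ^ N))"
        using L[OF \<open>x \<in> K\<close>] elim(1) h \<epsilon>
        by (intro norm_derivative_le_of_second_derivative[of h "\<lambda>s. u \<epsilon> (x + s *\<^sub>R b)" "\<lambda>s. partial_deriv b (u \<epsilon>) (x + s *\<^sub>R b)"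
            "\<lambda>s. partial_deriv b (partial_deriv b (u \<epsilon>)) (x + s *\<^sub>R b)"]
            smooth_has_vector_derivative_line smooth' elim) auto
      also have "norm (u \<epsilon> (x + h *\<^sub>R b)) \<le> D * (h * \<epsilon> ^ m)"
        using elim(2) L[of x h] \<open>x \<in> K\<close> h \<epsilon> by (auto simp: h_def power_add)
      also have "norm (u \<epsilon> (x + 0 *\<^sub>R b)) \<le> D * (h * \<epsilon> ^ m)"
        using elim(2) L[of x 0] \<open>x \<in> K\<close> h \<epsilon> by (auto simp: h_def power_add)
      also have "h * (h * (C / \<epsilon> ^ N)) = h * (C * \<epsilon> ^ m)" using \<epsilon> by (simp add: h_def power_add)
      finally have "h * norm (partial_deriv b (u \<epsilon>) x) \<le> h * ((2 * D + C) * \<epsilon> ^ m)"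
        by (simp add: algebra_simps)
      then show "norm (partial_deriv b (u \<epsilon>) x) \<le> (2 * D + C) * \<bar>\<epsilon> ^ m\<bar>" using h \<epsilon> by simp
    qed
  qed
qed

lemma negligible_iter_partial:
  assumes "u \<in> negligible_nets" "bs \<in> lists Basis"
  shows "(\<lambda>\<epsilon>. iter_partial bs (u \<epsilon>)) \<in> negligible_nets"
  using assms(2)
  by (induction bs) (auto simp: iter_partial_Cons intro: negligible_partial_deriv assms(1))

text \<open>The case \<open>m = 0\<close> of negligibility, applied to the derivatives. Boundedness
  is the form that every Zygmund weight absorbs.\<close>

lemma bigo_on_negligible:
  assumes "u \<in> negligible_nets" "bs \<in> lists Basis" "compact K"
  shows "bigo_on K (\<lambda>\<epsilon>. iter_partial bs (u \<epsilon>)) (\<lambda>\<epsilon>. 1)"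
proof -
  have "bigo_on K (\<lambda>\<epsilon>. iter_partial bs (u \<epsilon>)) (\<lambda>\<epsilon>. \<epsilon> ^ 0)"
    using negligible_iter_partial[OF assms(1,2)] assms(3) unfolding negligible_nets_iff by blast
  then show ?thesis by simp
qed

section \<open>Classes and change of representative\<close>

lemma colombeau_class_subset: "colombeau_class u \<subseteq> moderate_nets"
  by (auto simp: colombeau_class_def colombeau_rel_def)

lemma colombeauE:
  assumes "U \<in> colombeau"
  obtains w where "w \<in> moderate_nets" "U = colombeau_class w"
  using assms by (auto simp: colombeau_def colombeau_class_def quotient_def)

lemma colombeau_subset: "U \<in> colombeau \<Longrightarrow> U \<subseteq> moderate_nets"
  using colombeau_class_subset by (auto elim: colombeauE)

lemma iter_partial_zero: "iter_partial bs (\<lambda>x. 0) = (\<lambda>x. 0)"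
proof (induction bs)
  case (Cons b bs)
  have "partial_deriv b (\<lambda>x. 0) x = 0" for x :: 'a by (rule partial_deriv_eqI) simp
  with Cons show ?case by (auto simp: iter_partial_Cons)
qed simp

lemma zero_moderate: "(\<lambda>\<epsilon> x. 0) \<in> moderate_nets"
  by (auto simp: moderate_nets_iff smooth_def iter_partial_zero bigo_on_zero)

lemma colombeau_class_self:
  assumes "u \<in> moderate_nets"
  shows "u \<in> colombeau_class u"
  using assms zero_moderate
  by (auto simp: colombeau_class_def colombeau_rel_def negligible_nets_iff bigo_on_zero)

lemma colombeau_class_in_colombeau: "u \<in> moderate_nets \<Longrightarrow> colombeau_class u \<in> colombeau"
  by (auto simp: colombeau_def colombeau_class_def quotient_def)

text \<open>Representatives differ by a negligible net, all of whose derivatives are bounded and so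
  absorbed by \<open>g\<close>. Thus the single good representative provided by
  \<open>zygmund_loc\<close> gives the same bounds for every other one.\<close>

lemma bigo_on_representatives:
  assumes U: "U \<in> colombeau" "u \<in> U" "v \<in> U"
    and bs: "bs \<in> lists Basis" and K: "compact K"
    and u: "bigo_on K (\<lambda>\<epsilon>. iter_partial bs (u \<epsilon>)) g" and g: "(\<lambda>_. 1) \<in> O[at_right 0](g)"
  shows "bigo_on K (\<lambda>\<epsilon>. iter_partial bs (v \<epsilon>)) g"
proof -
  obtain w where w: "w \<in> moderate_nets" "U = colombeau_class w" using colombeauE[OF U(1)] .
  have uv: "u \<in> moderate_nets" "v \<in> moderate_nets"
    and n: "(\<lambda>\<epsilon> x. w \<epsilon> x - u \<epsilon> x) \<in> negligible_nets" "(\<lambda>\<epsilon> x. w \<epsilon> x - v \<epsilon> x) \<in> negligible_nets"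
    using U w by (auto simp: colombeau_class_def colombeau_rel_def)
  \<comment> \<open>Both nets are compared with the generator \<open>w\<close> of the class:
    \<open>v = u + ((w - u) - (w - v))\<close>.\<close>
  have "bigo_on K (\<lambda>\<epsilon> x. iter_partial bs (u \<epsilon>) x +
      (iter_partial bs (\<lambda>x. w \<epsilon> x - u \<epsilon> x) x - iter_partial bs (\<lambda>x. w \<epsilon> x - v \<epsilon> x) x)) g"
    by (intro bigo_on_add bigo_on_diff u bigo_on_trans[OF bigo_on_negligible g] n bs K)
  then show ?thesis
    by (rule bigo_on_cong_norm,
        use eventually_smooth[OF w(1)] eventually_smooth[OF uv(1)] eventually_smooth[OF uv(2)] in eventually_elim)
      (simp add: iter_partial_diff bs)
qed

section \<open>The weights of Zygmund regularity\<close>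

text \<open>With \<open>d = s - length bs\<close> the three cases of Zygmund regularity become one
  weight, indexed by the excess of the regularity over the order of differentiation.\<close>

definition zygmund_weight :: "real \<Rightarrow> real \<Rightarrow> real"
  where "zygmund_weight d \<epsilon> = (if d > 0 then 1 else if d = 0 then ln (1 / \<epsilon>) else \<epsilon> powr d)"

lemma one_bigo_ln: "(\<lambda>_. 1) \<in> O[at_right 0](\<lambda>\<epsilon>::real. ln (1 / \<epsilon>))"
  by real_asymp

lemma ln_bigo_powr: "p < 0 \<Longrightarrow> (\<lambda>\<epsilon>::real. ln (1 / \<epsilon>)) \<in> O[at_right 0](\<lambda>\<epsilon>. \<epsilon> powr p)"
  by real_asymp

lemma ln_ln_bigo_powr: "p < 0 \<Longrightarrow> (\<lambda>\<epsilon>::real. ln (1 / \<epsilon>) * ln (1 / \<epsilon>)) \<in> O[at_right 0](\<lambda>\<epsilon>. \<epsilon> powr p)"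
  by real_asymp

lemma ln_powr_bigo_powr:
  "p < q \<Longrightarrow> (\<lambda>\<epsilon>::real. ln (1 / \<epsilon>) * \<epsilon> powr q) \<in> O[at_right 0](\<lambda>\<epsilon>. \<epsilon> powr p)"
  by real_asymp

lemma one_bigo_powr: "(\<lambda>_. 1) \<in> O[at_right 0](\<lambda>\<epsilon>::real. \<epsilon> powr p)" if "p \<le> 0"
proof (rule bigoI[where c = 1], use eventually_unit_interval in eventually_elim)
  case (elim \<epsilon>)
  then show ?case using \<open>p \<le> 0\<close> powr_mono'[of p 0 \<epsilon>] by auto
qed

lemma zygmund_weight_antimono:
  assumes "e \<le> d"
  shows "zygmund_weight d \<in> O[at_right 0](zygmund_weight e)"
proof -
  consider "e > 0" "d > 0" | "e = 0" "d > 0" | "e = 0" "d = 0" | "e < 0" "d > 0" | "e < 0" "d = 0" | "e < 0" "d < 0"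
    using assms by linarith
  then show ?thesis
    using assms one_bigo_ln ln_bigo_powr[of e] one_bigo_powr[of e] powr_bigo_powr[of e d]
    by cases (simp_all add: zygmund_weight_def[abs_def])
qed

text \<open>Bounded terms, such as derivatives of negligible nets and of the residual of the
  equation, can be added to an estimate with any weight.\<close>

lemma one_bigo_zygmund_weight: "(\<lambda>_. 1) \<in> O[at_right 0](zygmund_weight d)"
proof -
  have "zygmund_weight (max d 1) = (\<lambda>_. 1)" by (auto simp: zygmund_weight_def fun_eq_iff)
  then show ?thesis using zygmund_weight_antimono[of d "max d 1"] by simp
qed

text \<open>If one index is positive, its weight is 1 and the first two hypotheses compare the other
  weight with that of \<open>f\<close>. Otherwise the product is a power, possibly with logarithms,
  and the strict inequality \<open>f < d + e\<close> leaves room to absorb them. For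
  \<open>d = s - i\<close>, \<open>e = r - l\<close> and \<open>f = r - (i + l)\<close> the
  hypotheses read \<open>r - l \<le> s\<close>, \<open>i > 0\<close> and \<open>s > 0\<close>;
  equality in the first is what permits \<open>r = s + 1\<close>.\<close>

lemma zygmund_weight_mult:
  assumes "f \<le> d" "f < e" "f < d + e"
  shows "(\<lambda>\<epsilon>. zygmund_weight d \<epsilon> * zygmund_weight e \<epsilon>) \<in> O[at_right 0](zygmund_weight f)"
proof -
  consider "d > 0" | "d = 0" "e > 0" | "d = 0" "e = 0" | "d = 0" "e < 0" | "d < 0" "e > 0" | "d < 0" "e = 0"
    | "d < 0" "e < 0" by linarith
  then show ?thesis
  proof cases
    case 1
    then have "(\<lambda>\<epsilon>. zygmund_weight d \<epsilon> * zygmund_weight e \<epsilon>) = zygmund_weight e" by (simp add: zygmund_weight_def fun_eq_iff)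
    then show ?thesis using zygmund_weight_antimono[of f e] assms by simp
  next
    case 2
    then have "(\<lambda>\<epsilon>. zygmund_weight d \<epsilon> * zygmund_weight e \<epsilon>) = zygmund_weight d" by (simp add: zygmund_weight_def fun_eq_iff)
    then show ?thesis using zygmund_weight_antimono[of f d] assms by simp
  next
    case 5
    then have "(\<lambda>\<epsilon>. zygmund_weight d \<epsilon> * zygmund_weight e \<epsilon>) = zygmund_weight d" by (simp add: zygmund_weight_def fun_eq_iff)
    then show ?thesis using zygmund_weight_antimono[of f d] assms by simp
  next
    case 3
    then show ?thesis using ln_ln_bigo_powr[of f] assms by (simp add: zygmund_weight_def[abs_def])
  next
    case 4
    then show ?thesis using ln_powr_bigo_powr[of f e] assms by (simp add: zygmund_weight_def[abs_def])
  next
    case 6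
    then show ?thesis using ln_powr_bigo_powr[of f d] assms by (simp add: zygmund_weight_def[abs_def] mult.commute)
  next
    case 7
    then show ?thesis using powr_bigo_powr[of f "d + e"] assms by (simp add: zygmund_weight_def[abs_def] powr_add)
  qed
qed

lemma bigo_on_zygmund_weight_iff:
  fixes s :: real
  assumes "u \<in> moderate_nets" "compact K" "K \<noteq> {}" "bs \<in> lists Basis"
  shows "bigo_on K (\<lambda>\<epsilon>. iter_partial bs (u \<epsilon>)) (zygmund_weight (s - length bs)) \<longleftrightarrow>
      (real (length bs) < s \<longrightarrow>
        (\<lambda>\<epsilon>. sup_norm_on K (iter_partial bs (u \<epsilon>))) \<in> O[at_right 0](\<lambda>\<epsilon>. 1)) \<and>
      (real (length bs) = s \<longrightarrow>
        (\<lambda>\<epsilon>. sup_norm_on K (iter_partial bs (u \<epsilon>))) \<in> O[at_right 0](\<lambda>\<epsilon>. ln (1 / \<epsilon>))) \<and>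
      (real (length bs) > s \<longrightarrow>
        (\<lambda>\<epsilon>. sup_norm_on K (iter_partial bs (u \<epsilon>)))
          \<in> O[at_right 0](\<lambda>\<epsilon>. \<epsilon> powr (s - real (length bs))))"
proof -
  have eq: "bigo_on K (\<lambda>\<epsilon>. iter_partial bs (u \<epsilon>)) (zygmund_weight (s - length bs)) \<longleftrightarrow>
      (\<lambda>\<epsilon>. sup_norm_on K (iter_partial bs (u \<epsilon>))) \<in> O[at_right 0](zygmund_weight (s - length bs))"
    using assms by (intro bigo_on_iff_sup_norm_on continuous_on_iter_partial moderate_netsD(1))
  consider "real (length bs) < s" | "real (length bs) = s" | "real (length bs) > s" by linarith
  then show ?thesis
    unfolding eq by cases (simp_all add: zygmund_weight_def[abs_def])
qed

lemma zygmund_loc_iff: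
  "U \<in> zygmund_loc s \<longleftrightarrow> U \<in> colombeau \<and> (\<exists>u\<in>U. \<forall>K. compact K \<longrightarrow>
    (\<forall>bs\<in>lists Basis. bigo_on K (\<lambda>\<epsilon>. iter_partial bs (u \<epsilon>)) (zygmund_weight (s - length bs))))"
  (is "_ \<longleftrightarrow> _ \<and> (\<exists>u\<in>U. \<forall>K. compact K \<longrightarrow> ?B u K)")
proof -
  have "bigo_on {} v g" for v :: "'a net" and g by (rule bigo_onI) simp
  then have empty: "?B u {}" for u by blast
  have mod: "u \<in> moderate_nets" if "U \<in> colombeau" "u \<in> U" for u using colombeau_subset that by blast
  have eq: "(compact K \<longrightarrow> K \<noteq> {} \<longrightarrow> ?B u K) \<longleftrightarrow> (compact K \<longrightarrow> ?B u K)" for u K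
    using empty by (cases "K = {}") simp_all
  have "U \<in> zygmund_loc s \<longleftrightarrow> U \<in> colombeau \<and> (\<exists>u\<in>U. \<forall>K. compact K \<longrightarrow> K \<noteq> {} \<longrightarrow> ?B u K)"
    unfolding zygmund_loc_def mem_Collect_eq
    by (intro conj_cong[OF refl] bex_cong[OF refl] all_cong1 imp_cong[OF refl] ball_cong[OF refl]
        bigo_on_zygmund_weight_iff[symmetric] mod) assumption+
  then show ?thesis unfolding eq .
qed

section \<open>Characteristics\<close>

lemma exists_antiderivative:
  fixes g :: "real \<Rightarrow> real"
  assumes "continuous_on UNIV g"
  shows "\<exists>A. \<forall>z\<in>{lo..hi}. (A has_real_derivative g z) (at z)"
proof (intro exI ballI)
  fix z assume z: "z \<in> {lo..hi}"
  \<comment> \<open>The integral starts at \<open>lo - 1\<close>, and the interval ends at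
    \<open>hi + 1\<close>, so that all points of \<open>{lo..hi}\<close> are interior and the
    derivative is two-sided.\<close>
  have "((\<lambda>x. integral {lo - 1..x} g) has_real_derivative g z) (at z within {lo - 1..hi + 1})"
    using z by (intro integral_has_real_derivative continuous_on_subset[OF assms]) auto
  then show "((\<lambda>x. integral {lo - 1..x} g) has_real_derivative g z) (at z)"
    using z by (simp add: at_within_Icc_at)
qed

text \<open>Characteristics are parametrised by \<open>x\<close> rather than by \<open>t\<close>: as graphs \<open>t = A x + const\<close>
  with \<open>A' = 1 / \<alpha>\<close> they need no inversion of \<open>A\<close>.\<close>

lemma transport_estimate:
  fixes v :: "real \<times> real \<Rightarrow> complex" and \<alpha> :: "real \<Rightarrow> real"
  assumes v: "\<And>p. (v has_derivative frechet_derivative v (at p)) (at p)"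
    and \<alpha>: "continuous_on UNIV \<alpha>" "\<And>x. c1 \<le> \<alpha> x" "\<And>x. \<alpha> x \<le> c2" and "c1 > 0"
    and xt: "\<bar>x\<bar> \<le> R" "\<bar>t\<bar> \<le> T"
    and G: "\<And>y \<tau>. \<bar>y\<bar> \<le> R + c2 * T \<Longrightarrow> \<bar>\<tau>\<bar> \<le> T \<Longrightarrow>
      norm (partial_deriv (0, 1) v (y, \<tau>) + complex_of_real (\<alpha> y) * partial_deriv (1, 0) v (y, \<tau>)) \<le> G"
  shows "\<exists>y. \<bar>y\<bar> \<le> R + c2 * T \<and> norm (v (x, t)) \<le> norm (v (y, 0)) + c2 * T / c1 * G"
proof -
  \<comment> \<open>The speed is at most \<open>c2\<close>, so the characteristic through
    \<open>(x, t)\<close> meets \<open>t = 0\<close> within distance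
    \<open>c2 * \<bar>t\<bar>\<close> of \<open>x\<close>.\<close>
  define lo hi where "lo = x - c2 * \<bar>t\<bar>" and "hi = x + c2 * \<bar>t\<bar>"
  have "c2 > 0" using \<alpha>(2,3)[of 0] \<open>c1 > 0\<close> by linarith
  have \<alpha>pos: "\<alpha> z > 0" for z using \<alpha>(2)[of z] \<open>c1 > 0\<close> by linarith
  have c2t: "0 \<le> c2 * \<bar>t\<bar>" "c2 * \<bar>t\<bar> \<le> c2 * T" using \<open>c2 > 0\<close> xt by auto
  then have x: "x \<in> {lo..hi}" by (simp add: lo_def hi_def)
  have R: "\<bar>z\<bar> \<le> R + c2 * T" if "z \<in> {lo..hi}" for z
    using that xt c2t by (auto simp: lo_def hi_def)
  have "continuous_on UNIV (\<lambda>z. 1 / \<alpha> z)"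
    using \<alpha>(1) \<alpha>pos by (intro continuous_intros) (auto simp: less_imp_neq[symmetric])
  then obtain A where A: "\<And>z. z \<in> {lo..hi} \<Longrightarrow> (A has_real_derivative 1 / \<alpha> z) (at z)"
    using exists_antiderivative by blast
  \<comment> \<open>The slope of \<open>A\<close> is \<open>1 / \<alpha>\<close>, hence at least
    \<open>1 / c2\<close>. Over a length \<open>c2 * \<bar>t\<bar>\<close> on either side of
    \<open>x\<close> the graph therefore moves by at least \<open>\<bar>t\<bar>\<close>, enough to
    cross zero.\<close>
  have grow: "(z' - z) / c2 \<le> A z' - A z" if "lo \<le> z" "z \<le> z'" "z' \<le> hi" for z z'
  proof (cases "z = z'")
    case False
    with that have "\<exists>y>z. y < z' \<and> A z' - A z = (z' - z) * (1 / \<alpha> y)"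
      by (intro MVT2 A) auto
    then obtain y where "A z' - A z = (z' - z) * (1 / \<alpha> y)" by blast
    moreover have "(z' - z) * (1 / c2) \<le> (z' - z) * (1 / \<alpha> y)"
      using that \<alpha>(3) \<alpha>pos \<open>c2 > 0\<close> by (intro mult_left_mono) (auto simp: frac_le)
    ultimately show ?thesis by simp
  qed simp
  have mono: "A z \<le> A z'" if "lo \<le> z" "z \<le> z'" "z' \<le> hi" for z z'
    using grow[OF that] that \<open>c2 > 0\<close> by (smt (verit) divide_nonneg_pos)
  \<comment> \<open>The characteristic through \<open>(x, t)\<close>, written as a graph over the
    x-axis.\<close>
  define \<theta> where "\<theta> z = t + A z - A x" for z
  have "\<theta> lo \<le> 0" "0 \<le> \<theta> hi"
    using grow[of lo x] grow[of x hi] x \<open>c2 > 0\<close> by (auto simp: \<theta>_def lo_def hi_def)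
  moreover have "isCont \<theta> z" if "lo \<le> z \<and> z \<le> hi" for z
    unfolding \<theta>_def using that by (intro continuous_intros DERIV_isCont[OF A]) auto
  ultimately obtain y where y: "lo \<le> y" "y \<le> hi" "\<theta> y = 0"
    using IVT[of \<theta> lo 0 hi] x by auto
  \<comment> \<open>By monotonicity the arc between the foot \<open>y\<close> and \<open>x\<close>
    stays at times between 0 and \<open>t\<close>, inside the region where \<open>G\<close> bounds
    the residual.\<close>
  have seg: "z \<in> {lo..hi}" "\<bar>\<theta> z\<bar> \<le> T" if "z \<in> closed_segment y x" for z
  proof -
    show z: "z \<in> {lo..hi}" using that x y by (auto simp: closed_segment_eq_real_ivl split: if_splits)
    have "\<theta> x = t" by (simp add: \<theta>_def)
    moreover have "\<theta> x \<le> \<theta> z \<and> \<theta> z \<le> \<theta> y \<or> \<theta> y \<le> \<theta> z \<and> \<theta> z \<le> \<theta> x"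
      using that x y z mono[of y z] mono[of z x] mono[of x z] mono[of z y]
      unfolding \<theta>_def by (auto simp: closed_segment_eq_real_ivl split: if_splits)
    ultimately show "\<bar>\<theta> z\<bar> \<le> T" using y(3) xt by linarith
  qed
  have "norm (v (x, \<theta> x) - v (y, \<theta> y)) \<le> G / c1 * norm (x - y)"
  proof (rule differentiable_bound)
    fix z assume z: "z \<in> closed_segment y x"
    let ?D = "frechet_derivative v (at (z, \<theta> z))"
    have "(\<theta> has_real_derivative 1 / \<alpha> z) (at z)"
      unfolding \<theta>_def using A[OF seg(1)[OF z]] by (auto intro!: derivative_eq_intros)
    then have "(\<theta> has_derivative (\<lambda>k. k * (1 / \<alpha> z))) (at z within closed_segment y x)"
      using has_derivative_at_withinI unfolding has_field_derivative_def mult.commute[of "1 / \<alpha> z"] by blast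
    then have "((\<lambda>z. (z, \<theta> z)) has_derivative (\<lambda>k. (k, k * (1 / \<alpha> z)))) (at z within closed_segment y x)"
      by (intro has_derivative_Pair has_derivative_ident)
    from has_derivative_compose[OF this v]
    show "((\<lambda>z. v (z, \<theta> z)) has_derivative (\<lambda>k. ?D (k, k * (1 / \<alpha> z)))) (at z within closed_segment y x)" .
    have lin: "linear ?D" using v has_derivative_linear by blast
    \<comment> \<open>The tangent of the graph is a multiple of the transport direction, so the
      derivative of \<open>v\<close> along it is the residual divided by \<alpha>, at most
      \<open>G / c1\<close> in norm.\<close>
    have dec: "(k, k * (1 / \<alpha> z)) = (k / \<alpha> z) *\<^sub>R ((0, 1) + \<alpha> z *\<^sub>R (1, 0))" for k
      using \<alpha>pos[of z] by simp
    have "?D (k, k * (1 / \<alpha> z)) = (k / \<alpha> z) *\<^sub>R (partial_deriv (0, 1) v (z, \<theta> z)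
        + complex_of_real (\<alpha> z) * partial_deriv (1, 0) v (z, \<theta> z))" for k
      unfolding dec partial_deriv_def linear_scale[OF lin] linear_add[OF lin] by (simp add: scaleR_conv_of_real)
    moreover have "norm (partial_deriv (0, 1) v (z, \<theta> z)
        + complex_of_real (\<alpha> z) * partial_deriv (1, 0) v (z, \<theta> z)) \<le> G" (is "norm ?E \<le> G")
      using G[OF R[OF seg(1)[OF z]] seg(2)[OF z]] .
    moreover have "\<bar>k\<bar> / \<alpha> z * norm ?E \<le> \<bar>k\<bar> / c1 * G" for k
      using calculation(2) \<alpha>(2)[of z] \<alpha>pos[of z] \<open>c1 > 0\<close> by (intro mult_mono divide_left_mono) auto
    ultimately have "norm (?D (k, k * (1 / \<alpha> z))) \<le> G / c1 * norm k" for k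
      using \<alpha>pos[of z] by (simp add: mult.commute)
    then show "onorm (\<lambda>k. ?D (k, k * (1 / \<alpha> z))) \<le> G / c1" by (rule onorm_le)
  qed auto
  also have "\<dots> \<le> G / c1 * (c2 * T)"
  proof (intro mult_left_mono)
    show "norm (x - y) \<le> c2 * T" using y c2t by (auto simp: lo_def hi_def)
    have "0 \<le> G" using order_trans[OF norm_ge_zero G[of x t]] R[OF x] xt by blast
    then show "0 \<le> G / c1" using \<open>c1 > 0\<close> by simp
  qed
  finally have "norm (v (x, t) - v (y, 0)) \<le> c2 * T / c1 * G"
    using y(3) by (simp add: \<theta>_def mult_ac)
  moreover have "norm (v (x, t)) \<le> norm (v (y, 0)) + norm (v (x, t) - v (y, 0))"
    by (rule norm_triangle_sub)
  ultimately show ?thesis using R[of y] y by (intro exI[of _ y]) auto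
qed

section \<open>Nets on the plane\<close>

lemma Basis_plane: "(Basis :: (real \<times> real) set) = {(1, 0), (0, 1)}"
  by (auto simp: Basis_prod_def)

lemma eq_x_direction:
  assumes "bs \<in> lists (Basis :: (real \<times> real) set)" "(0, 1) \<notin> set bs" "b \<in> set bs"
  shows "b = (1, 0)"
proof -
  have "b \<in> {(1, 0), (0, 1)}" using assms(1,3) unfolding Basis_plane by auto
  with assms(2,3) show ?thesis by blast
qed

lemma map_fst_lists_Basis:
  assumes "bs \<in> lists (Basis :: (real \<times> real) set)" "(0, 1) \<notin> set bs"
  shows "map fst bs \<in> lists Basis"
  using eq_x_direction[OF assms] by fastforce

lemma map_Pair_0_lists_Basis:
  "bs \<in> lists (Basis :: real set) \<Longrightarrow> map (\<lambda>b. (b, 0)) bs \<in> lists (Basis :: (real \<times> real) set)"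
  by (auto simp: Basis_plane)

lemma iter_partial_const_in_t:
  fixes f :: "real \<Rightarrow> complex"
  assumes f: "smooth f" and bs: "bs \<in> lists Basis"
  shows "iter_partial bs (\<lambda>(x, t :: real). f x) =
    (if (0, 1) \<in> set bs then (\<lambda>_. 0) else (\<lambda>(x, t). iter_partial (map fst bs) f x))"
  using bs
proof (induction bs)
  case (Cons b bs)
  have IH: "iter_partial bs (\<lambda>(x, t). f x) =
      (if (0, 1) \<in> set bs then (\<lambda>_. 0) else (\<lambda>(x, t). iter_partial (map fst bs) f x))"
    using Cons by simp
  show ?case
  proof (cases "(0, 1) \<in> set bs")
    case True
    then show ?thesis using IH iter_partial_zero[of "[b]"] by (simp add: iter_partial_Cons)
  next
    case False
    then have "map fst bs \<in> lists Basis" using Cons.hyps by (intro map_fst_lists_Basis)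
    then have D: "(iter_partial (map fst bs) f has_derivative frechet_derivative (iter_partial (map fst bs) f) (at x)) (at x)" for x
      by (intro smooth_has_derivative smooth_iter_partial f)
    have "partial_deriv b (\<lambda>(x, t). iter_partial (map fst bs) f x) (x, t) =
        frechet_derivative (iter_partial (map fst bs) f) (at x) (fst b)" for x t
      unfolding case_prod_unfold
      by (rule partial_deriv_eqI) (use has_derivative_compose[OF has_derivative_fst[OF has_derivative_ident] D] in auto)
    then have eq: "iter_partial (b # bs) (\<lambda>(x, t). f x) =
        (\<lambda>(x, t). partial_deriv (fst b) (iter_partial (map fst bs) f) x)"
      unfolding iter_partial_Cons IH using False by (simp add: fun_eq_iff partial_deriv_def)
    \<comment> \<open>The time direction projects to the zero vector, in whose direction every
      derivative vanishes.\<close>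
    have "partial_deriv 0 (iter_partial (map fst bs) f) x = 0" for x
      using linear_0[OF has_derivative_linear[OF D]] by (simp add: partial_deriv_def)
    moreover have "b = (1, 0) \<or> b = (0, 1)" using Cons.hyps by (simp add: Basis_plane)
    ultimately show ?thesis using False unfolding eq
      by (elim disjE) (simp_all add: iter_partial_Cons)
  qed
qed simp

lemma has_derivative_at_time_0:
  fixes f :: "real \<times> real \<Rightarrow> complex"
  assumes "smooth f"
  shows "((\<lambda>x. f (x, 0)) has_derivative (\<lambda>k. frechet_derivative f (at (x, 0)) (k, 0))) (at x)"
  by (rule has_derivative_compose[OF has_derivative_Pair[OF has_derivative_ident has_derivative_const]
        smooth_has_derivative[OF assms]])

lemma iter_partial_at_time_0:
  fixes f :: "real \<times> real \<Rightarrow> complex"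
  assumes f: "smooth f" and bs: "bs \<in> lists Basis"
  shows "iter_partial bs (\<lambda>x. f (x, 0)) = (\<lambda>x. iter_partial (map (\<lambda>b. (b, 0)) bs) f (x, 0))"
  using bs
proof (induction bs)
  case (Cons b bs)
  then have "map (\<lambda>b. (b, 0)) bs \<in> lists (Basis :: (real \<times> real) set)" by (intro map_Pair_0_lists_Basis) auto
  then have "partial_deriv b (\<lambda>x. iter_partial (map (\<lambda>b. (b, 0)) bs) f (x, 0)) x =
      partial_deriv (b, 0) (iter_partial (map (\<lambda>b. (b, 0)) bs) f) (x, 0)" for x
    unfolding partial_deriv_def[of "(b, 0)"]
    by (intro partial_deriv_eqI has_derivative_at_time_0 smooth_iter_partial f)
  with Cons show ?case by (auto simp: iter_partial_Cons)
qed simp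

lemma smooth_const_in_t:
  fixes f :: "real \<Rightarrow> complex"
  assumes f: "smooth f"
  shows "smooth (\<lambda>(x, t :: real). f x)"
  unfolding smooth_def
proof (intro ballI allI)
  fix bs :: "(real \<times> real) list" and p assume bs: "bs \<in> lists Basis"
  show "iter_partial bs (\<lambda>(x, t). f x) differentiable at p"
  proof (cases "(0, 1) \<in> set bs")
    case False
    then have fst: "map fst bs \<in> lists Basis" using bs by (intro map_fst_lists_Basis) auto
    then have "(iter_partial (map fst bs) f has_derivative frechet_derivative (iter_partial (map fst bs) f) (at x)) (at x)" for x
      by (intro smooth_has_derivative smooth_iter_partial f)
    from has_derivative_compose[OF has_derivative_fst[OF has_derivative_ident] this, of p UNIV]
    show ?thesis using False unfolding iter_partial_const_in_t[OF f bs]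
      by (simp add: case_prod_unfold differentiableI)
  qed (simp add: iter_partial_const_in_t[OF f bs])
qed

lemma smooth_at_time_0:
  fixes f :: "real \<times> real \<Rightarrow> complex"
  assumes f: "smooth f"
  shows "smooth (\<lambda>x. f (x, 0))"
  unfolding smooth_def
proof (intro ballI allI)
  fix bs :: "real list" and x assume bs: "bs \<in> lists Basis"
  then have "map (\<lambda>b. (b, 0)) bs \<in> lists (Basis :: (real \<times> real) set)" by (intro map_Pair_0_lists_Basis)
  then show "iter_partial bs (\<lambda>x. f (x, 0)) differentiable at x"
    unfolding iter_partial_at_time_0[OF f bs]
    by (intro differentiableI[OF has_derivative_at_time_0] smooth_iter_partial f)
qed

text \<open>A list containing the time direction gives derivative zero, so a bound has to be
  supplied only for pure x-derivatives, and only on the projection of \<open>K\<close>.\<close>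

lemma bigo_on_const_in_t:
  fixes a :: "real net" and bs :: "(real \<times> real) list"
  assumes a: "a \<in> moderate_nets" and bs: "bs \<in> lists Basis"
    and bnd: "(0, 1) \<notin> set bs \<Longrightarrow> bigo_on (fst ` K) (\<lambda>\<epsilon>. iter_partial (map fst bs) (a \<epsilon>)) g"
  shows "bigo_on K (\<lambda>\<epsilon>. iter_partial bs (\<lambda>(x, t). a \<epsilon> x)) g"
proof (cases "(0, 1) \<in> set bs")
  case True
  show ?thesis
    by (rule bigo_on_cong_norm[OF bigo_on_zero], use eventually_smooth[OF a] in eventually_elim)
      (simp add: iter_partial_const_in_t bs True)
next
  case False
  have "\<forall>\<^sub>F \<epsilon> in at_right 0. \<forall>p\<in>K. \<exists>x\<in>fst ` K.
      norm (iter_partial bs (\<lambda>(x, t). a \<epsilon> x) p) \<le> 1 * norm (iter_partial (map fst bs) (a \<epsilon>) x)"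
    using eventually_smooth[OF a]
  proof eventually_elim
    case (elim \<epsilon>)
    show ?case
    proof
      fix p assume "p \<in> K"
      then show "\<exists>x\<in>fst ` K.
          norm (iter_partial bs (\<lambda>(x, t). a \<epsilon> x) p) \<le> 1 * norm (iter_partial (map fst bs) (a \<epsilon>) x)"
        unfolding iter_partial_const_in_t[OF elim bs]
        by (intro bexI[of _ "fst p"]) (auto simp: False case_prod_unfold)
    qed
  qed
  from bigo_on_dominated[OF bnd[OF False] this] show ?thesis by simp
qed

lemma moderate_const_in_t:
  fixes a :: "real net"
  assumes "a \<in> moderate_nets"
  shows "(\<lambda>\<epsilon> (x, t :: real). a \<epsilon> x) \<in> moderate_nets"
  unfolding moderate_nets_iff
proof (intro conjI ballI allI impI)
  fix K :: "(real \<times> real) set" and bs :: "(real \<times> real) list"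
  assume K: "compact K" and bs: "bs \<in> lists Basis"
  show "\<exists>N::nat. bigo_on K (\<lambda>\<epsilon>. iter_partial bs (\<lambda>(x, t :: real). a \<epsilon> x)) (\<lambda>\<epsilon>. 1 / \<epsilon> ^ N)"
  proof (cases "(0, 1) \<in> set bs")
    case True
    then show ?thesis using bigo_on_const_in_t[OF assms bs] by blast
  next
    case False
    then have fst: "map fst bs \<in> lists Basis" using bs by (intro map_fst_lists_Basis) auto
    have "compact (fst ` K)" using K by (intro compact_continuous_image continuous_on_fst) auto
    from moderate_netsD(2)[OF assms this fst] show ?thesis
      using bigo_on_const_in_t[OF assms bs] by blast
  qed
qed (intro smooth_const_in_t moderate_netsD(1)[OF assms])

lemma bigo_on_at_time_0:
  fixes u :: "(real \<times> real) net"
  assumes u: "u \<in> moderate_nets" and bs: "bs \<in> lists Basis"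
  shows "bigo_on K (\<lambda>\<epsilon>. iter_partial bs (\<lambda>x. u \<epsilon> (x, 0))) g \<longleftrightarrow>
    bigo_on (K \<times> {0}) (\<lambda>\<epsilon>. iter_partial (map (\<lambda>b. (b, 0)) bs) (u \<epsilon>)) g"
  (is "bigo_on K ?v g \<longleftrightarrow> bigo_on (K \<times> {0}) ?w g")
proof -
  have "\<forall>\<^sub>F \<epsilon> in at_right 0. \<forall>x. ?v \<epsilon> x = ?w \<epsilon> (x, 0)"
    using eventually_smooth[OF u] by eventually_elim (simp add: iter_partial_at_time_0[OF _ bs])
  then have "\<forall>\<^sub>F \<epsilon> in at_right 0. (\<forall>x\<in>K. norm (?v \<epsilon> x) \<le> C * \<bar>g \<epsilon>\<bar>) \<longleftrightarrow>
      (\<forall>p\<in>K \<times> {0}. norm (?w \<epsilon> p) \<le> C * \<bar>g \<epsilon>\<bar>)" for C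
    by eventually_elim auto
  then show ?thesis unfolding bigo_on_def by (intro ex_cong1 conj_cong refl eventually_cong)
qed

lemma moderate_at_time_0:
  fixes u :: "(real \<times> real) net"
  assumes "u \<in> moderate_nets"
  shows "(\<lambda>\<epsilon> x. u \<epsilon> (x, 0)) \<in> moderate_nets"
  unfolding moderate_nets_iff
proof (intro conjI ballI allI impI)
  fix K :: "real set" and bs :: "real list"
  assume "compact K" and bs: "bs \<in> lists Basis"
  then have "compact (K \<times> {0::real})" "map (\<lambda>b. (b, 0)) bs \<in> lists (Basis :: (real \<times> real) set)"
    by (auto intro!: compact_Times map_Pair_0_lists_Basis)
  from moderate_netsD(2)[OF assms this]
  show "\<exists>N::nat. bigo_on K (\<lambda>\<epsilon>. iter_partial bs (\<lambda>x. u \<epsilon> (x, 0))) (\<lambda>\<epsilon>. 1 / \<epsilon> ^ N)"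
    unfolding bigo_on_at_time_0[OF assms bs] .
qed (intro smooth_at_time_0 moderate_netsD(1)[OF assms])

section \<open>Regularity of solutions of the transport equation\<close>

text \<open>Collects the estimates on nets to which the problem is reduced. The residual enters only
  through bounded derivatives, and \<open>r\<close> and \<open>s\<close> are linked solely by
  \<open>weight_mult\<close>, so the cases \<open>s > 0\<close> and \<open>s = 0\<close> share all
  that follows.\<close>

locale transport_net =
  fixes a :: "real net" and w :: "(real \<times> real) net" and c1 c2 r s :: real
  assumes a: "a \<in> moderate_nets" and w: "w \<in> moderate_nets"
    and c1: "c1 > 0"
    and a_bounds: "\<And>\<epsilon> x. \<epsilon> \<in> {0<..<1} \<Longrightarrow> a \<epsilon> x \<in> \<real> \<and> c1 \<le> Re (a \<epsilon> x) \<and> Re (a \<epsilon> x) \<le> c2"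
    and residual: "\<And>K bs. compact K \<Longrightarrow> bs \<in> lists Basis \<Longrightarrow>
      bigo_on K (\<lambda>\<epsilon>. iter_partial bs (\<lambda>p. partial_deriv (0, 1) (w \<epsilon>) p +
        (\<lambda>(x, t). a \<epsilon> x) p * partial_deriv (1, 0) (w \<epsilon>) p)) (\<lambda>_. 1)"
    and a_zygmund: "\<And>K bs. compact K \<Longrightarrow> bs \<in> lists Basis \<Longrightarrow>
      bigo_on K (\<lambda>\<epsilon>. iter_partial bs (a \<epsilon>)) (zygmund_weight (s - length bs))"
    and initial: "\<And>K bs. compact K \<Longrightarrow> bs \<in> lists Basis \<Longrightarrow>
      bigo_on K (\<lambda>\<epsilon>. iter_partial bs (\<lambda>x. w \<epsilon> (x, 0))) (zygmund_weight (r - length bs))"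
    and weight_mult: "\<And>i l. i \<ge> 1 \<Longrightarrow> l \<ge> 1 \<Longrightarrow>
      (\<lambda>\<epsilon>. zygmund_weight (s - real i) \<epsilon> * zygmund_weight (r - real l) \<epsilon>) \<in> O[at_right 0](zygmund_weight (r - real (i + l)))"
begin

definition A :: "(real \<times> real) net"
  where "A = (\<lambda>\<epsilon> (x, t). a \<epsilon> x)"

text \<open>The residual of \<open>w\<close> in the transport equation; it is negligible when
  \<open>w\<close> represents a solution.\<close>

definition n :: "(real \<times> real) net"
  where "n = (\<lambda>\<epsilon> p. partial_deriv (0, 1) (w \<epsilon>) p + A \<epsilon> p * partial_deriv (1, 0) (w \<epsilon>) p)"

lemma A: "A \<in> moderate_nets"
  unfolding A_def by (rule moderate_const_in_t[OF a])

lemma bigo_on_n: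
  assumes "compact K" "bs \<in> lists Basis"
  shows "bigo_on K (\<lambda>\<epsilon>. iter_partial bs (n \<epsilon>)) (zygmund_weight d)"
  using bigo_on_trans[OF residual one_bigo_zygmund_weight] assms unfolding n_def A_def .

lemma A_bounds:
  assumes "\<epsilon> \<in> {0<..<1}"
  shows "A \<epsilon> p = complex_of_real (Re (a \<epsilon> (fst p)))" "c1 \<le> norm (A \<epsilon> p)" "norm (A \<epsilon> p) \<le> c2"
proof -
  show eq: "A \<epsilon> p = complex_of_real (Re (a \<epsilon> (fst p)))"
    using a_bounds[OF assms, of "fst p"] by (simp add: A_def case_prod_unfold complex_is_Real_iff complex_eq_iff)
  show "c1 \<le> norm (A \<epsilon> p)" "norm (A \<epsilon> p) \<le> c2"
    unfolding eq norm_of_real using a_bounds[OF assms, of "fst p"] c1 by auto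
qed

text \<open>Estimates one Leibniz term. The second factor always carries a derivative, which gives
  the condition \<open>l \<ge> 1\<close> of \<open>weight_mult\<close>.\<close>

lemma bigo_on_A_mult:
  assumes K: "compact K" and p: "p \<in> lists Basis" and q: "length q \<ge> 1"
    and v: "bigo_on K (\<lambda>\<epsilon>. iter_partial q (w \<epsilon>)) (zygmund_weight (r - length q))"
  shows "bigo_on K (\<lambda>\<epsilon> z. iter_partial p (A \<epsilon>) z * iter_partial q (w \<epsilon>) z)
    (zygmund_weight (r - real (length p + length q)))"
proof (cases "p = []")
  case True
  \<comment> \<open>Undifferentiated, the coefficient is bounded by \<open>c2\<close>. Its Zygmund
    weight of order 0 would be a logarithm for \<open>s = 0\<close>.\<close>
  have "bigo_on K A (\<lambda>_. 1)"
    by (rule bigo_onI[where C = c2], use eventually_unit_interval in eventually_elim) (simp add: A_bounds(3))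
  from bigo_on_mult[OF this v] show ?thesis by (simp add: True)
next
  case False
  have "bigo_on K (\<lambda>\<epsilon>. iter_partial p (A \<epsilon>)) (zygmund_weight (s - length p))"
    unfolding A_def
  proof (rule bigo_on_const_in_t[OF a p])
    assume "(0, 1) \<notin> set p"
    then have "map fst p \<in> lists Basis" using p by (intro map_fst_lists_Basis) auto
    from a_zygmund[OF _ this, of "fst ` K"] K
    show "bigo_on (fst ` K) (\<lambda>\<epsilon>. iter_partial (map fst p) (a \<epsilon>)) (zygmund_weight (s - length p))"
      by (simp add: compact_continuous_image continuous_on_fst)
  qed
  from bigo_on_trans[OF bigo_on_mult[OF this v] weight_mult] False q show ?thesis
    by (cases p) auto
qed

text \<open>The differentiated equation. It is solved for the time derivative when bounding initial
  values, and for the Leibniz term with undifferentiated \<open>A\<close> when recovering mixed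
  derivatives.\<close>

lemma iter_partial_A_w_x:
  assumes "smooth (w \<epsilon>)" "smooth (A \<epsilon>)" "cs \<in> lists Basis"
  shows "iter_partial cs (n \<epsilon>) z = iter_partial (cs @ [(0, 1)]) (w \<epsilon>) z +
    (\<Sum>(p, q)\<leftarrow>splits cs. iter_partial p (A \<epsilon>) z * iter_partial (q @ [(1, 0)]) (w \<epsilon>) z)"
proof -
  have "smooth (partial_deriv b (w \<epsilon>))" if "b \<in> {(1, 0), (0, 1)}" for b
    using that by (intro smooth_partial_deriv assms) (auto simp: Basis_plane)
  then show ?thesis unfolding n_def using assms
    by (simp add: iter_partial_add iter_partial_mult smooth_mult iter_partial_snoc)
qed

text \<open>Induction on the number of time directions. The equation trades one of them for the
  residual and for products of derivatives of \<open>A\<close> with derivatives of \<open>w\<close>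
  having fewer time directions; the total order of each product is unchanged, so
  \<open>bigo_on_A_mult\<close> returns the required weight.\<close>

lemma bigo_on_initial:
  assumes K: "compact K" and bs: "bs \<in> lists Basis"
  shows "bigo_on (K \<times> {0}) (\<lambda>\<epsilon>. iter_partial bs (w \<epsilon>)) (zygmund_weight (r - length bs))"
  using bs
proof (induction "count (mset bs) (0, 1)" arbitrary: bs rule: less_induct)
  case less
  show ?case
  proof (cases "(0, 1) \<in> set bs")
    case False
    have fst: "map fst bs \<in> lists Basis" by (rule map_fst_lists_Basis[OF less.prems False])
    have eq: "map (\<lambda>b. (b, 0)) (map fst bs) = bs"
      unfolding map_map o_def using eq_x_direction[OF less.prems False] by (intro map_idI) fastforce
    from initial[OF K fst] bigo_on_at_time_0[OF w fst] eq show ?thesis by simp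
  next
    case True
    then obtain cs where cs: "cs \<in> lists Basis" "mset bs = add_mset (0, 1) (mset cs)"
        "\<And>f. smooth f \<Longrightarrow> iter_partial bs f = iter_partial cs (partial_deriv (0, 1) f)"
      using iter_partial_move_last[OF less.prems] by metis
    have len: "length bs = Suc (length cs)" using arg_cong[OF cs(2), of size] by simp
    have K0: "compact (K \<times> {0::real})" using K by (intro compact_Times) auto
    have "bigo_on (K \<times> {0}) (\<lambda>\<epsilon> z. iter_partial p (A \<epsilon>) z * iter_partial (q @ [(1, 0)]) (w \<epsilon>) z)
        (zygmund_weight (r - length bs))" if pq: "(p, q) \<in> set (splits cs)" for p q
    proof -
      \<comment> \<open>The time directions of \<open>q\<close> are among those of
        \<open>cs\<close>, which has one fewer than \<open>bs\<close>; the appended direction is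
        spatial.\<close>
      have "count (mset (q @ [(1, 0)])) (0, 1) < count (mset bs) (0, 1)"
        using arg_cong[OF mset_splits[OF pq], of "\<lambda>M. count M (0, 1)"] cs(2) by simp
      moreover have "p \<in> lists Basis" "q @ [(1, 0)] \<in> lists Basis"
        using splits_lists[OF pq cs(1)] by (auto simp: Basis_plane)
      ultimately have "bigo_on (K \<times> {0}) (\<lambda>\<epsilon> z. iter_partial p (A \<epsilon>) z * iter_partial (q @ [(1, 0)]) (w \<epsilon>) z)
          (zygmund_weight (r - real (length p + length (q @ [(1, 0)]))))"
        by (intro bigo_on_A_mult K0 less.hyps) auto
      then show ?thesis using length_splits[OF pq] len by simp
    qed
    then have "bigo_on (K \<times> {0}) (\<lambda>\<epsilon> z. \<Sum>(p, q)\<leftarrow>splits cs. iter_partial p (A \<epsilon>) z * iter_partial (q @ [(1, 0)]) (w \<epsilon>) z)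
        (zygmund_weight (r - length bs))"
      unfolding case_prod_unfold by (intro bigo_on_sum_list) auto
    from bigo_on_diff[OF bigo_on_n[OF K0 cs(1)] this] show ?thesis
      by (rule bigo_on_cong_norm, use eventually_smooth[OF w] eventually_smooth[OF A] in eventually_elim)
        (simp add: iter_partial_A_w_x cs iter_partial_snoc)
  qed
qed

text \<open>The coefficient is independent of time, so the transport operator commutes with the time
  derivative: no Leibniz term beyond the leading one appears.\<close>

lemma transport_time_derivative:
  assumes sm: "smooth (w \<epsilon>)" "smooth (a \<epsilon>)"
  shows "iter_partial (replicate j (0, 1)) (n \<epsilon>) =
    (\<lambda>z. partial_deriv (0, 1) (iter_partial (replicate j (0, 1)) (w \<epsilon>)) z +
      A \<epsilon> z * partial_deriv (1, 0) (iter_partial (replicate j (0, 1)) (w \<epsilon>)) z)"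
proof (induction j)
  case (Suc j)
  let ?v = "iter_partial (replicate j (0, 1)) (w \<epsilon>)"
  have B: "(0, 1) \<in> (Basis :: (real \<times> real) set)" "(1, 0) \<in> (Basis :: (real \<times> real) set)"
    by (auto simp: Basis_plane)
  have v: "smooth ?v" using B by (intro smooth_iter_partial sm) auto
  have smA: "smooth (A \<epsilon>)" unfolding A_def by (intro smooth_const_in_t sm)
  have A_t: "partial_deriv (0, 1) (A \<epsilon>) = (\<lambda>_. 0)"
    using iter_partial_const_in_t[OF sm(2), of "[(0, 1)]"] B by (simp add: A_def iter_partial_Cons)
  have "partial_deriv (0, 1) (\<lambda>z. partial_deriv (0, 1) ?v z + A \<epsilon> z * partial_deriv (1, 0) ?v z) =
      (\<lambda>z. partial_deriv (0, 1) (partial_deriv (0, 1) ?v) z + A \<epsilon> z * partial_deriv (0, 1) (partial_deriv (1, 0) ?v) z)"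
    using iter_partial_add[of "partial_deriv (0, 1) ?v" "\<lambda>z. A \<epsilon> z * partial_deriv (1, 0) ?v z" "[(0, 1)]"]
      iter_partial_mult[of "A \<epsilon>" "partial_deriv (1, 0) ?v" "[(0, 1)]"] B v smA A_t
    by (simp add: iter_partial_Cons smooth_mult smooth_partial_deriv)
  then show ?case
    using Suc partial_deriv_commute[OF v B] by (simp add: iter_partial_Cons)
qed (simp add: n_def)

text \<open>The pure time derivative solves a transport equation with right-hand side the time
  derivative of \<open>n\<close>, whose bound is absorbed by the weight. Integration along
  characteristics then reduces to the bounds at time 0.\<close>

lemma bigo_on_time_derivative:
  assumes K: "compact K"
  shows "bigo_on K (\<lambda>\<epsilon>. iter_partial (replicate j (0, 1)) (w \<epsilon>)) (zygmund_weight (r - real j))"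
proof -
  let ?ts = "replicate j (0, 1) :: (real \<times> real) list"
  have ts: "?ts \<in> lists Basis" by (auto simp: Basis_plane)
  obtain B where B: "\<And>p. p \<in> K \<Longrightarrow> norm p \<le> B" using compact_imp_bounded[OF K] bounded_iff by blast
  \<comment> \<open>A domain of dependence: characteristics from points of norm at most
    \<open>B\<close> to time 0 travel at most \<open>c2 * B\<close> in space.\<close>
  define L where "L = {- (B + c2 * B)..B + c2 * B}"
  have L: "compact L" "compact (L \<times> {- B..B})" unfolding L_def by (auto intro: compact_Times)
  obtain C where C: "\<forall>\<^sub>F \<epsilon> in at_right 0. \<forall>p\<in>L \<times> {- B..B}. norm (iter_partial ?ts (n \<epsilon>) p) \<le> C * \<bar>zygmund_weight (r - real j) \<epsilon>\<bar>"
    using bigo_onE[OF bigo_on_n[OF L(2) ts]] by blast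
  obtain D where D: "\<forall>\<^sub>F \<epsilon> in at_right 0. \<forall>p\<in>L \<times> {0}. norm (iter_partial ?ts (w \<epsilon>) p) \<le> D * \<bar>zygmund_weight (r - real j) \<epsilon>\<bar>"
    using bigo_onE[OF bigo_on_initial[OF L(1) ts]] by auto
  show ?thesis
  proof (rule bigo_onI[where C = "D + c2 * B / c1 * C"],
      use C D eventually_smooth[OF w] eventually_smooth[OF a] eventually_unit_interval in eventually_elim)
    case (elim \<epsilon>)
    let ?v = "iter_partial ?ts (w \<epsilon>)" and ?\<alpha> = "\<lambda>x. Re (a \<epsilon> x)"
    show ?case
    proof
      fix p assume "p \<in> K"
      obtain x t where p: "p = (x, t)" by (cases p)
      have xt: "\<bar>x\<bar> \<le> B" "\<bar>t\<bar> \<le> B"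
        using B[OF \<open>p \<in> K\<close>] norm_fst_le[of x t] norm_snd_le[of t x] by (auto simp: p)
      have "\<exists>y. \<bar>y\<bar> \<le> B + c2 * B \<and> norm (?v (x, t)) \<le> norm (?v (y, 0)) +
          c2 * B / c1 * (C * \<bar>zygmund_weight (r - real j) \<epsilon>\<bar>)"
      proof (rule transport_estimate[where \<alpha> = ?\<alpha> and R = B and T = B])
        show "(?v has_derivative frechet_derivative ?v (at p)) (at p)" for p
          using elim ts by (intro smooth_has_derivative smooth_iter_partial)
        show "continuous_on UNIV ?\<alpha>" using elim by (intro continuous_intros smooth_continuous_on)
        fix y \<tau> assume "\<bar>y\<bar> \<le> B + c2 * B" "\<bar>\<tau>\<bar> \<le> B"
        then have "norm (iter_partial ?ts (n \<epsilon>) (y, \<tau>)) \<le> C * \<bar>zygmund_weight (r - real j) \<epsilon>\<bar>"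
          using elim(1) by (auto simp: L_def abs_le_iff)
        then show "norm (partial_deriv (0, 1) ?v (y, \<tau>) + complex_of_real (?\<alpha> y) * partial_deriv (1, 0) ?v (y, \<tau>))
            \<le> C * \<bar>zygmund_weight (r - real j) \<epsilon>\<bar>"
          using elim A_bounds(1)[of \<epsilon> "(y, \<tau>)"] by (simp add: transport_time_derivative)
      qed (use a_bounds elim c1 xt in auto)
      then obtain y where y: "\<bar>y\<bar> \<le> B + c2 * B" "norm (?v (x, t)) \<le> norm (?v (y, 0)) +
          c2 * B / c1 * (C * \<bar>zygmund_weight (r - real j) \<epsilon>\<bar>)" by blast
      then have "norm (?v (y, 0)) \<le> D * \<bar>zygmund_weight (r - real j) \<epsilon>\<bar>"
        using elim(2) by (auto simp: L_def abs_le_iff)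
      with y(2) show "norm (?v p) \<le> (D + c2 * B / c1 * C) * \<bar>zygmund_weight (r - real j) \<epsilon>\<bar>"
        by (simp add: p algebra_simps)
    qed
  qed
qed

text \<open>A list without x-directions is a pure time derivative. Otherwise one x-direction is
  exchanged for a time direction through the equation. The induction measure adds order and number
  of x-directions: the exchange keeps the order and lowers the count, whereas the terms with
  differentiated \<open>A\<close> lower the order without raising the count.\<close>

lemma zygmund_regularity:
  assumes K: "compact K" and bs: "bs \<in> lists Basis"
  shows "bigo_on K (\<lambda>\<epsilon>. iter_partial bs (w \<epsilon>)) (zygmund_weight (r - length bs))"
  using bs
proof (induction "length bs + count (mset bs) (1, 0)" arbitrary: bs rule: less_induct)
  case less
  show ?case
  proof (cases "(1, 0) \<in> set bs")
    case False
    with less.prems have "bs = replicate (length bs) (0, 1)"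
      by (intro replicate_eqI) (auto simp: Basis_plane)
    then show ?thesis using bigo_on_time_derivative[OF K, of "length bs"] by simp
  next
    case True
    then obtain cs where cs: "cs \<in> lists Basis" "mset bs = add_mset (1, 0) (mset cs)"
        "\<And>f. smooth f \<Longrightarrow> iter_partial bs f = iter_partial cs (partial_deriv (1, 0) f)"
      using iter_partial_move_last[OF less.prems] by metis
    have len: "length bs = Suc (length cs)" using arg_cong[OF cs(2), of size] by simp
    obtain ps where ps: "splits cs = ps @ [([], cs)]" "\<And>p q. (p, q) \<in> set ps \<Longrightarrow> p \<noteq> []"
      using splits_eq_Cons[of cs] by blast
    have "bigo_on K (\<lambda>\<epsilon> z. iter_partial p (A \<epsilon>) z * iter_partial (q @ [(1, 0)]) (w \<epsilon>) z)
        (zygmund_weight (r - length bs))" if "(p, q) \<in> set ps" for p q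
    proof -
      have pq: "(p, q) \<in> set (splits cs)" "p \<noteq> []" using that ps by auto
      \<comment> \<open>Since \<open>p\<close> is nonempty, the order drops by at least one; the
        appended x-direction only restores the one removed from \<open>bs\<close>.\<close>
      have "length (q @ [(1, 0)]) + count (mset (q @ [(1, 0)])) (1, 0) < length bs + count (mset bs) (1, 0)"
        using arg_cong[OF mset_splits[OF pq(1)], of "\<lambda>M. count M (1, 0)"] length_splits[OF pq(1)] pq(2) cs(2) len
        by (auto simp flip: length_greater_0_conv)
      moreover have "p \<in> lists Basis" "q @ [(1, 0)] \<in> lists Basis"
        using splits_lists[OF pq(1) cs(1)] by (auto simp: Basis_plane)
      ultimately have "bigo_on K (\<lambda>\<epsilon> z. iter_partial p (A \<epsilon>) z * iter_partial (q @ [(1, 0)]) (w \<epsilon>) z)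
          (zygmund_weight (r - real (length p + length (q @ [(1, 0)]))))"
        by (intro bigo_on_A_mult K less.hyps) auto
      then show ?thesis using length_splits[OF pq(1)] len by simp
    qed
    then have lower: "bigo_on K (\<lambda>\<epsilon> z. \<Sum>(p, q)\<leftarrow>ps. iter_partial p (A \<epsilon>) z * iter_partial (q @ [(1, 0)]) (w \<epsilon>) z)
        (zygmund_weight (r - length bs))"
      unfolding case_prod_unfold by (intro bigo_on_sum_list) auto
    have "bigo_on K (\<lambda>\<epsilon>. iter_partial (cs @ [(0, 1)]) (w \<epsilon>)) (zygmund_weight (r - length (cs @ [(0, 1)])))"
      using cs(1,2) len by (intro less.hyps) (auto simp: Basis_plane)
    then have "bigo_on K (\<lambda>\<epsilon>. iter_partial (cs @ [(0, 1)]) (w \<epsilon>)) (zygmund_weight (r - length bs))"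
      by (simp add: len)
    from bigo_on_diff[OF bigo_on_diff[OF bigo_on_n[OF K cs(1)] this] lower]
    \<comment> \<open>After the lower terms are subtracted, what remains of the Leibniz sum is the
      term with undifferentiated \<open>A\<close>, which is the wanted derivative multiplied by
      \<open>A\<close>.\<close>
    have "bigo_on K (\<lambda>\<epsilon> z. A \<epsilon> z * iter_partial bs (w \<epsilon>) z) (zygmund_weight (r - length bs))"
      by (rule bigo_on_cong_norm, use eventually_smooth[OF w] eventually_smooth[OF A] in eventually_elim)
        (simp add: iter_partial_A_w_x cs ps(1) iter_partial_snoc)
    then show ?thesis
    proof (rule bigo_on_dominated[where B = "1 / c1"], use eventually_unit_interval in eventually_elim)
      case (elim \<epsilon>)
      show ?case
      proof
        fix z assume "z \<in> K"
        \<comment> \<open>Ellipticity in \<open>x\<close>: the lower bound \<open>c1\<close> allows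
          division by the coefficient at the cost of a constant.\<close>
        have "c1 * norm (iter_partial bs (w \<epsilon>) z) \<le> norm (A \<epsilon> z) * norm (iter_partial bs (w \<epsilon>) z)"
          using A_bounds(2)[OF elim] by (intro mult_right_mono) auto
        then have "norm (iter_partial bs (w \<epsilon>) z) \<le> 1 / c1 * norm (A \<epsilon> z * iter_partial bs (w \<epsilon>) z)"
          using c1 by (simp add: norm_mult field_simps)
        then show "\<exists>y\<in>K. norm (iter_partial bs (w \<epsilon>) z) \<le> 1 / c1 * norm (A \<epsilon> y * iter_partial bs (w \<epsilon>) y)"
          using \<open>z \<in> K\<close> by blast
      qed
    qed (use c1 in simp)
  qed
qed

end

section \<open>From equations between classes to estimates on representatives\<close>

text \<open>The operations are unions of classes, and a moderate net lies in the class that it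
  generates. Such memberships turn an equality of classes into information about one chosen net; the
  next four lemmas serve the same purpose.\<close>

lemma in_G_add:
  "u \<in> U \<Longrightarrow> v \<in> V \<Longrightarrow> (\<lambda>\<epsilon> x. u \<epsilon> x + v \<epsilon> x) \<in> moderate_nets \<Longrightarrow>
    (\<lambda>\<epsilon> x. u \<epsilon> x + v \<epsilon> x) \<in> G_add U V"
  unfolding G_add_def
  by (rule UN_I, assumption, rule UN_I, assumption, rule colombeau_class_self)

lemma in_G_mult:
  "u \<in> U \<Longrightarrow> v \<in> V \<Longrightarrow> (\<lambda>\<epsilon> x. u \<epsilon> x * v \<epsilon> x) \<in> moderate_nets \<Longrightarrow>
    (\<lambda>\<epsilon> x. u \<epsilon> x * v \<epsilon> x) \<in> G_mult U V"
  unfolding G_mult_def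
  by (rule UN_I, assumption, rule UN_I, assumption, rule colombeau_class_self)

lemma in_G_partial:
  "u \<in> U \<Longrightarrow> (\<lambda>\<epsilon>. partial_deriv b (u \<epsilon>)) \<in> moderate_nets \<Longrightarrow>
    (\<lambda>\<epsilon>. partial_deriv b (u \<epsilon>)) \<in> G_partial b U"
  unfolding G_partial_def by (rule UN_I, assumption, rule colombeau_class_self)

lemma in_G_initial:
  "u \<in> U \<Longrightarrow> (\<lambda>\<epsilon> x. u \<epsilon> (x, 0)) \<in> moderate_nets \<Longrightarrow>
    (\<lambda>\<epsilon> x. u \<epsilon> (x, 0)) \<in> G_initial U"
  unfolding G_initial_def by (rule UN_I, assumption, rule colombeau_class_self)

lemma in_G_const_in_t:
  "a \<in> U \<Longrightarrow> (\<lambda>\<epsilon> (x, t :: real). a \<epsilon> x) \<in> moderate_nets \<Longrightarrow>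
    (\<lambda>\<epsilon> (x, t). a \<epsilon> x) \<in> G_const_in_t U"
  unfolding G_const_in_t_def by (rule UN_I, assumption, rule colombeau_class_self)

text \<open>Any representative \<open>w\<close> of the solution satisfies the assumptions of
  \<open>transport_net\<close>. The admissible relation between \<open>r\<close> and
  \<open>s\<close> is left to \<open>mult\<close>, since it is verified differently for
  \<open>s > 0\<close> and \<open>s = 0\<close>.\<close>

lemma zygmund_transport:
  fixes s \<tau> r c1 c2 :: real
  assumes a: "a \<in> moderate_nets" and az: "colombeau_class a \<in> zygmund_loc s"
    and c1: "c1 > 0"
    and bounds: "\<And>\<epsilon> x. \<epsilon> \<in> {0<..<1} \<Longrightarrow> a \<epsilon> x \<in> \<real> \<and> c1 \<le> Re (a \<epsilon> x) \<and> Re (a \<epsilon> x) \<le> c2"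
    and bz: "b \<in> zygmund_loc \<tau>"
    and sol: "transport_solution (colombeau_class a) b u"
    and "r \<le> \<tau>"
    and mult: "\<And>i l. i \<ge> 1 \<Longrightarrow> l \<ge> 1 \<Longrightarrow>
      (\<lambda>\<epsilon>. zygmund_weight (s - real i) \<epsilon> * zygmund_weight (r - real l) \<epsilon>) \<in> O[at_right 0](zygmund_weight (r - real (i + l)))"
  shows "u \<in> zygmund_loc r"
proof -
  have u: "u \<in> colombeau" using sol by (simp add: transport_solution_def)
  then obtain w where w: "w \<in> moderate_nets" "u = colombeau_class w" by (rule colombeauE)
  have wu: "w \<in> u" using colombeau_class_self w by simp
  define A where "A = (\<lambda>\<epsilon> (x::real, t::real). a \<epsilon> x)"
  define n where "n = (\<lambda>\<epsilon> p. partial_deriv (0, 1) (w \<epsilon>) p + A \<epsilon> p * partial_deriv (1, 0) (w \<epsilon>) p)"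
  have A: "A \<in> moderate_nets" unfolding A_def by (rule moderate_const_in_t[OF a])
  have wt: "(\<lambda>\<epsilon>. partial_deriv (0, 1) (w \<epsilon>)) \<in> moderate_nets"
    and wx: "(\<lambda>\<epsilon>. partial_deriv (1, 0) (w \<epsilon>)) \<in> moderate_nets"
    by (intro moderate_partial_deriv w; simp add: Basis_plane)+
  have Awx: "(\<lambda>\<epsilon> p. A \<epsilon> p * partial_deriv (1, 0) (w \<epsilon>) p) \<in> moderate_nets"
    by (intro moderate_mult A wx)
  have "n \<in> G_add (G_partial (0, 1) u) (G_mult (G_const_in_t (colombeau_class a)) (G_partial (1, 0) u))"
    unfolding n_def
    by (intro in_G_add in_G_mult in_G_partial moderate_add wu wt wx Awx)
      (use in_G_const_in_t[OF colombeau_class_self[OF a]] A in \<open>simp add: A_def\<close>)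
  then have nz: "n \<in> G_zero" using sol by (simp add: transport_solution_def)
  \<comment> \<open>The zero net represents the same class as \<open>n\<close>, so its trivial
    bounds pass to \<open>n\<close> with the weight 1.\<close>
  have n: "bigo_on K (\<lambda>\<epsilon>. iter_partial bs (n \<epsilon>)) (\<lambda>_. 1)" if "compact K" "bs \<in> lists Basis" for K bs
    using that
    by (intro bigo_on_representatives[OF colombeau_class_in_colombeau[OF zero_moderate]
          colombeau_class_self[OF zero_moderate] nz[unfolded G_zero_def]])
      (simp_all add: iter_partial_zero bigo_on_zero)
  have w0: "(\<lambda>\<epsilon> x. w \<epsilon> (x, 0)) \<in> moderate_nets" by (rule moderate_at_time_0[OF w(1)])
  have "(\<lambda>\<epsilon> x. w \<epsilon> (x, 0)) \<in> G_initial u" by (rule in_G_initial[OF wu w0])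
  then have w0b: "(\<lambda>\<epsilon> x. w \<epsilon> (x, 0)) \<in> b" using sol by (simp add: transport_solution_def)
  obtain \<beta> where \<beta>: "b \<in> colombeau" "\<beta> \<in> b" "\<And>K bs. compact K \<Longrightarrow> bs \<in> lists Basis \<Longrightarrow>
      bigo_on K (\<lambda>\<epsilon>. iter_partial bs (\<beta> \<epsilon>)) (zygmund_weight (\<tau> - length bs))"
    using bz unfolding zygmund_loc_iff by blast
  obtain \<alpha> where \<alpha>: "colombeau_class a \<in> colombeau" "\<alpha> \<in> colombeau_class a" "\<And>K bs. compact K \<Longrightarrow> bs \<in> lists Basis \<Longrightarrow>
      bigo_on K (\<lambda>\<epsilon>. iter_partial bs (\<alpha> \<epsilon>)) (zygmund_weight (s - length bs))"
    using az unfolding zygmund_loc_iff by blast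
  interpret transport_net a w c1 c2 r s
  proof
    fix K :: "real set" and bs :: "real list" assume K: "compact K" "bs \<in> lists Basis"
    \<comment> \<open>The Zygmund bounds are known for some representatives \<alpha> and \<beta>
      only. They are transferred to the given \<open>a\<close> and to the trace of \<open>w\<close>,
      the latter after weakening \<tau> to \<open>r\<close>.\<close>
    show "bigo_on K (\<lambda>\<epsilon>. iter_partial bs (a \<epsilon>)) (zygmund_weight (s - length bs))"
      by (rule bigo_on_representatives[OF \<alpha>(1,2) colombeau_class_self[OF a] K(2,1) \<alpha>(3)[OF K] one_bigo_zygmund_weight])
    show "bigo_on K (\<lambda>\<epsilon>. iter_partial bs (\<lambda>x. w \<epsilon> (x, 0))) (zygmund_weight (r - length bs))"
      by (rule bigo_on_representatives[OF \<beta>(1,2) w0b K(2,1) _ one_bigo_zygmund_weight])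
        (rule bigo_on_trans[OF \<beta>(3)[OF K] zygmund_weight_antimono], use \<open>r \<le> \<tau>\<close> in simp)
  qed (use a w c1 bounds n[unfolded n_def A_def] mult in \<open>blast+\<close>)
  show ?thesis unfolding zygmund_loc_iff using u wu zygmund_regularity by (intro conjI bexI[of _ w] allI impI ballI)
qed

theorem theorem16:
  fixes s \<tau> c1 c2 :: real
    and a :: "real net"
    and b :: "real net set"
    and u :: "(real \<times> real) net set"
  assumes "s \<ge> 0"
    and "a \<in> moderate_nets"
    and "colombeau_class a \<in> zygmund_loc s"
    and "c1 > 0" and "c2 > 0"
    and "\<And>\<epsilon> x. \<epsilon> \<in> {0<..<1} \<Longrightarrow> a \<epsilon> x \<in> \<real> \<and> c1 \<le> Re (a \<epsilon> x) \<and> Re (a \<epsilon> x) \<le> c2"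
    and "b \<in> zygmund_loc \<tau>"
    and "transport_solution (colombeau_class a) b u"
  shows "(s > 0 \<longrightarrow> u \<in> zygmund_loc (min \<tau> (s + 1))) \<and>
         (s = 0 \<longrightarrow> (\<forall>\<sigma>>0. u \<in> zygmund_loc (min \<tau> 1 - \<sigma>)))"
proof (intro conjI impI allI)
  note transport = zygmund_transport[OF assms(2,3,4,6,7,8)]
  show "u \<in> zygmund_loc (min \<tau> (s + 1))" if "s > 0"
  proof (rule transport)
    \<comment> \<open>The three conditions of \<open>zygmund_weight_mult\<close> hold because
      \<open>min \<tau> (s + 1) - l \<le> s\<close> for \<open>l \<ge> 1\<close>, because
      \<open>i \<ge> 1\<close>, and because \<open>s > 0\<close>.\<close>
    fix i l :: nat assume "i \<ge> 1" "l \<ge> 1"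
    with that show "(\<lambda>\<epsilon>. zygmund_weight (s - real i) \<epsilon> * zygmund_weight (min \<tau> (s + 1) - real l) \<epsilon>)
        \<in> O[at_right 0](zygmund_weight (min \<tau> (s + 1) - real (i + l)))"
      by (intro zygmund_weight_mult) auto
  qed auto
  show "u \<in> zygmund_loc (min \<tau> 1 - \<sigma>)" if "s = 0" "\<sigma> > 0" for \<sigma>
  proof (rule transport)
    fix i l :: nat assume "i \<ge> 1" "l \<ge> 1"
    \<comment> \<open>For \<open>s = 0\<close> the margin \<sigma> keeps the regularity below 1, so
      no weight is a logarithm or constant: all three are pure powers with negative exponents, and
      these multiply exactly.\<close>
    with that have neg: "s - real i < 0" "min \<tau> 1 - \<sigma> - real l < 0" "min \<tau> 1 - \<sigma> - real (i + l) < 0"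
      and eq: "min \<tau> 1 - \<sigma> - real (i + l) = (s - real i) + (min \<tau> 1 - \<sigma> - real l)" by auto
    have "(\<lambda>\<epsilon>. zygmund_weight (s - real i) \<epsilon> * zygmund_weight (min \<tau> 1 - \<sigma> - real l) \<epsilon>)
        = zygmund_weight (min \<tau> 1 - \<sigma> - real (i + l))"
      using neg unfolding zygmund_weight_def eq by (simp add: powr_add)
    then show "(\<lambda>\<epsilon>. zygmund_weight (s - real i) \<epsilon> * zygmund_weight (min \<tau> 1 - \<sigma> - real l) \<epsilon>)
        \<in> O[at_right 0](zygmund_weight (min \<tau> 1 - \<sigma> - real (i + l)))" by simp
  qed (use that in auto)
qed

end
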